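(* Let $M$ be a smooth, closed, oriented surface. For a generic immersion of $M$ into $\mathbb R^4$, the Gauss map $g:M\to Gr^+(2,4)$ is an immersion; that is, the set of immersions of $M$ into $\mathbb R^4$ whose Gauss map is an immersion is open and dense in the set $I(M,\mathbb R^4)$ of all immersions.
   Context: $C^\infty(M,\mathbb R^4)$ carries the Whitney $C^\infty$ topology (uniform convergence of every $k$-jet, $k=0,1,2,\dots$), and $I(M,\mathbb R^4)$ is an open subset with the induced topology. A property of maps in $I(M,\mathbb R^4)$ is called generic if the subset of maps with this property is open and dense in $I(M,\mathbb R^4)$. $Gr^+(2,4)$ is the manifold of oriented $2$-dimensional linear subspaces of $\mathbb R^4$, identified with a submanifold of $\Lambda^2\mathbb R^4$ by sending an oriented plane with positive orthonormal basis $(v_1,v_2)$ to $v_1\wedge v_2$. The Gauss map of an immersed oriented surface sends $p$ to its oriented tangent plane, $g(p)=e_1(p)\wedge e_2(p)$, where $(e_1(p),e_2(p))$ is a positive orthonormal basis of the tangent plane at $p$. *)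

theory Defs
  imports "HOL-Analysis.Analysis"
begin

text \<open>Iterated partial derivatives: \<open>pderivs [i1, ..., ik] f\<close> is
  \<open>D_i1 (... (D_ik f))\<close>. Only meaningful where the functions involved are differentiable.\<close>

primrec pderivs :: "'n list \<Rightarrow> (real^'n::finite \<Rightarrow> 'b::real_normed_vector) \<Rightarrow> real^'n \<Rightarrow> 'b" where
  "pderivs [] f = f"
| "pderivs (i # is) f = (\<lambda>x. frechet_derivative (pderivs is f) (at x) (axis i 1))"

text \<open>\<open>C\<^sup>\<infinity>\<close> on an open set: differentiability of all partial derivatives includes their
  continuity.\<close>

definition smooth_on :: "(real^'n::finite) set \<Rightarrow> (real^'n \<Rightarrow> 'b::real_normed_vector) \<Rightarrow> bool" where
  "smooth_on W f \<longleftrightarrow> (\<forall>is. \<forall>x\<in>W. pderivs is f differentiable (at x))"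

text \<open>A chart is a pair \<open>(U, \<phi>)\<close> of its domain and its coordinate map; the values of \<open>\<phi>\<close> outside
  \<open>U\<close> are irrelevant.\<close>

type_synonym 'a chart = "'a set \<times> ('a \<Rightarrow> real^2)"

abbreviation chart_inv :: "'a chart \<Rightarrow> real^2 \<Rightarrow> 'a" where
  "chart_inv c \<equiv> inv_into (fst c) (snd c)"

definition is_chart :: "'a topology \<Rightarrow> 'a chart \<Rightarrow> bool" where
  "is_chart M c \<longleftrightarrow> openin M (fst c) \<and> open (snd c ` fst c) \<and>
     homeomorphic_map (subtopology M (fst c)) (top_of_set (snd c ` fst c)) (snd c)"

definition oriented_compatible :: "'a chart \<Rightarrow> 'a chart \<Rightarrow> bool" where
  "oriented_compatible c d \<longleftrightarrow>
     (let W = snd c ` (fst c \<inter> fst d); \<tau> = snd d \<circ> chart_inv c in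
        smooth_on W \<tau> \<and> (\<forall>x\<in>W. 0 < det (matrix (frechet_derivative \<tau> (at x)))))"

text \<open>The smooth structure and the orientation are given by an oriented atlas \<open>A\<close>, which need not
  be maximal; the notions below do not change if \<open>A\<close> is enlarged by compatible charts. The
  surface need not be connected. Second countability follows from compactness and the charts.\<close>

definition closed_oriented_surface :: "'a topology \<Rightarrow> 'a chart set \<Rightarrow> bool" where
  "closed_oriented_surface M A \<longleftrightarrow>
     Hausdorff_space M \<and> compact_space M \<and>
     (\<forall>c\<in>A. is_chart M c) \<and> (\<Union>c\<in>A. fst c) = topspace M \<and>
     (\<forall>c\<in>A. \<forall>d\<in>A. oriented_compatible c d)"

text \<open>Maps on \<open>M\<close> are extensional (\<open>undefined\<close> outside \<open>topspace M\<close>), so that equality of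
  HOL functions is equality of maps on \<open>M\<close>.\<close>

definition smooth_maps :: "'a topology \<Rightarrow> 'a chart set \<Rightarrow> ('a \<Rightarrow> 'b::real_normed_vector) set" where
  "smooth_maps M A = {f \<in> extensional (topspace M).
     \<forall>c\<in>A. smooth_on (snd c ` fst c) (f \<circ> chart_inv c)}"

text \<open>The differential of \<open>f\<close> at \<open>p\<close>, read in the chart \<open>c\<close> around \<open>p\<close>.\<close>

definition chart_deriv :: "'a chart \<Rightarrow> ('a \<Rightarrow> 'b::real_normed_vector) \<Rightarrow> 'a \<Rightarrow> real^2 \<Rightarrow> 'b" where
  "chart_deriv c f p = frechet_derivative (f \<circ> chart_inv c) (at (snd c p))"

text \<open>Immersions of \<open>M\<close> into an embedded submanifold \<open>N\<close> of a normed space: for such \<open>N\<close>,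
  smoothness and the differential of a map into \<open>N\<close> are those of the map into the ambient
  space.\<close>

definition immersions ::
  "'a topology \<Rightarrow> 'a chart set \<Rightarrow> 'b::real_normed_vector set \<Rightarrow> ('a \<Rightarrow> 'b) set" where
  "immersions M A N = {f \<in> smooth_maps M A. f ` topspace M \<subseteq> N \<and>
     (\<forall>c\<in>A. \<forall>p\<in>fst c. inj (chart_deriv c f p))}"

text \<open>Maps whose \<open>k\<close>-jet is uniformly \<open>\<epsilon>\<close>-close to that of \<open>f\<close> on the compact subset \<open>K\<close> of the
  domain of \<open>c\<close>.\<close>

definition jet_nbhd :: "'a topology \<Rightarrow> 'a chart set \<Rightarrow> ('a \<Rightarrow> 'b::real_normed_vector) \<Rightarrow>
    'a chart \<Rightarrow> 'a set \<Rightarrow> nat \<Rightarrow> real \<Rightarrow> ('a \<Rightarrow> 'b) set" where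
  "jet_nbhd M A f c K k \<epsilon> = {g \<in> smooth_maps M A.
     \<forall>is. length is \<le> k \<longrightarrow> (\<forall>p\<in>K.
       norm (pderivs is (g \<circ> chart_inv c) (snd c p) - pderivs is (f \<circ> chart_inv c) (snd c p)) < \<epsilon>)}"

text \<open>The Whitney \<open>C\<^sup>\<infinity>\<close> topology for compact \<open>M\<close>. The whole space is added to the
  subbasis only for the case of the empty surface with the empty atlas.\<close>

definition whitney_topology ::
  "'a topology \<Rightarrow> 'a chart set \<Rightarrow> ('a \<Rightarrow> 'b::real_normed_vector) topology" where
  "whitney_topology M A = topology_generated_by (insert (smooth_maps M A)
     {jet_nbhd M A f c K k \<epsilon> | f c K k \<epsilon>.
        f \<in> smooth_maps M A \<and> c \<in> A \<and> compactin M K \<and> K \<subseteq> fst c \<and> 0 < \<epsilon>})"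

definition immersion_space :: "'a topology \<Rightarrow> 'a chart set \<Rightarrow> ('a \<Rightarrow> real^4) topology" where
  "immersion_space M A = subtopology (whitney_topology M A) (immersions M A UNIV)"

definition generic :: "'x topology \<Rightarrow> ('x \<Rightarrow> bool) \<Rightarrow> bool" where
  "generic X P \<longleftrightarrow>
     openin X {x \<in> topspace X. P x} \<and> X closure_of {x \<in> topspace X. P x} = topspace X"

text \<open>\<open>\<Lambda>\<^sup>2 \<real>\<^sup>4\<close> is realised as the space of skew-symmetric \<open>4 \<times> 4\<close> matrices, with
  \<open>v \<and> w\<close> corresponding to \<open>v w\<^sup>T - w v\<^sup>T\<close>.\<close>

definition wedge :: "real^4 \<Rightarrow> real^4 \<Rightarrow> real^4^4" where
  "wedge v w = (\<chi> i j. v $ i * w $ j - w $ i * v $ j)"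

definition orthonormal2 :: "real^4 \<Rightarrow> real^4 \<Rightarrow> bool" where
  "orthonormal2 v w \<longleftrightarrow> norm v = 1 \<and> norm w = 1 \<and> v \<bullet> w = 0"

definition oriented_Gr :: "(real^4^4) set" where
  "oriented_Gr = {wedge v w | v w. orthonormal2 v w}"

text \<open>Positive orthonormal bases of the tangent plane of the immersed surface at \<open>p\<close>: images under
  the differential of pairs \<open>(a, b)\<close> that are positively oriented in an oriented chart.\<close>

definition tangent_onb ::
  "'a chart set \<Rightarrow> ('a \<Rightarrow> real^4) \<Rightarrow> 'a \<Rightarrow> real^4 \<Rightarrow> real^4 \<Rightarrow> bool" where
  "tangent_onb A f p v w \<longleftrightarrow> orthonormal2 v w \<and>
     (\<exists>c\<in>A. p \<in> fst c \<and> (\<exists>a b :: real^2. 0 < det (vector [a, b] :: real^2^2) \<and>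
        v = chart_deriv c f p a \<and> w = chart_deriv c f p b))"

text \<open>For an immersion \<open>f\<close>, such bases exist and all give the same bivector.\<close>

definition gauss_map :: "'a topology \<Rightarrow> 'a chart set \<Rightarrow> ('a \<Rightarrow> real^4) \<Rightarrow> 'a \<Rightarrow> real^4^4" where
  "gauss_map M A f = (\<lambda>p\<in>topspace M. THE \<omega>. \<exists>v w. tangent_onb A f p v w \<and> \<omega> = wedge v w)"

end

theory Submission
  imports Defs
begin

text \<open>
  In a chart write \<open>f\<^sub>i\<close> and \<open>f\<^sub>i\<^sub>j\<close> for the partial derivatives of an immersion \<open>f\<close>. The Gauss map is the
  bivector field \<open>\<Omega> = f\<^sub>1 \<and> f\<^sub>2\<close> divided by its length (up to the factor \<open>sqrt 2\<close>), so its differential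
  kills a direction \<open>X\<close> exactly if the derivative of \<open>\<Omega>\<close> along \<open>X\<close> is a multiple of \<open>\<Omega>\<close>
  (\<open>inj_derivative_normalized_iff\<close>). Thus the Gauss map is an immersion at a point if and only if
  \<open>\<Omega>\<close>, \<open>\<partial>\<^sub>1\<Omega>\<close> and \<open>\<partial>\<^sub>2\<Omega>\<close> are linearly independent there, which is an open condition on the 2-jet of \<open>f\<close>
  (\<open>inj_gauss_deriv_iff\<close>, \<open>open_gauss_regular_jets\<close>). Since \<open>M\<close> is covered by finitely many compact
  cells inside charts, and an open condition on the jets over a compact set is open in the Whitney
  topology (\<open>openin_whitney_jet2\<close>), the good immersions form an open set.

  Density is a dimension count. If the derivative of \<open>\<Omega>\<close> along \<open>X\<close> is a multiple of \<open>\<Omega>\<close>, then both vectors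
  \<open>\<Sum>\<^sub>i X\<^sub>i f\<^sub>i\<^sub>j\<close> lie in the tangent plane, the span of \<open>f\<^sub>1\<close> and \<open>f\<^sub>2\<close> (\<open>wedge_relation_in_span\<close>). For a given
  direction \<open>X\<close> these are four conditions; the direction can vary in a one-parameter family, so the
  degenerate 2-jets have codimension three, and a generic map from a surface avoids them. The count
  is made precise by perturbing the map by polynomials of degree at most two without constant term,
  which form a space of dimension 20. A polynomial for which the
  perturbed map degenerates at some point is determined by the point (2 parameters), the direction
  (1), the coefficients of the two vectors above with respect to the first derivatives (4), the first
  derivatives of the perturbed map (8) and one remaining second derivative (4). Hence the bad
  polynomials are contained in the image of a differentiable map from a space of dimension 19. Such an
  image is negligible, and arbitrarily small good polynomials exist (\<open>generic_quad_map\<close>). Cut off by a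
  bump function, they make the Gauss map regular over one cell (\<open>dense_on_cell\<close>). The cells are treated one
  after the other, each perturbation being so small that it preserves what was achieved before.
\<close>

section \<open>Calculus of iterated partial derivatives\<close>

definition partial :: "'n \<Rightarrow> (real^'n::finite \<Rightarrow> 'b::real_normed_vector) \<Rightarrow> real^'n \<Rightarrow> 'b" where
  "partial i f = (\<lambda>x. frechet_derivative f (at x) (axis i 1))"

text \<open>The partial derivatives are peeled off from the inside, \<open>pderivs (is @ [i]) f = pderivs is (partial i f)\<close>,
  whereas \<open>pderivs\<close> itself puts them on the outside. This is the direction that makes closure properties
  provable by induction on \<open>k\<close>: the Leibniz and chain rules express \<open>partial i\<close> of a compound through
  functions of one order less. All partial derivatives of order at most \<open>k\<close> are
  differentiable, so the condition lies between \<open>k\<close> and \<open>k + 1\<close> times continuously differentiable.\<close>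

primrec diff_order :: "nat \<Rightarrow> (real^'n::finite) set \<Rightarrow> (real^'n \<Rightarrow> 'b::real_normed_vector) \<Rightarrow> bool" where
  "diff_order 0 W f \<longleftrightarrow> (\<forall>x\<in>W. f differentiable (at x))"
| "diff_order (Suc k) W f \<longleftrightarrow> (\<forall>x\<in>W. f differentiable (at x)) \<and> (\<forall>i. diff_order k W (partial i f))"

lemma pderivs_snoc: "pderivs (js @ [i]) f = pderivs js (partial i f)"
  by (induction js) (auto simp: partial_def)

lemma diff_order_iff_pderivs:
  "diff_order k W f \<longleftrightarrow> (\<forall>js. length js \<le> k \<longrightarrow> (\<forall>x\<in>W. pderivs js f differentiable (at x)))"
proof (induction k arbitrary: f)
  case (Suc k)
  show ?case (is "?L \<longleftrightarrow> ?R")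
  proof
    assume L: ?L
    show ?R
    proof (intro allI impI)
      fix js :: "'a list"
      assume len: "length js \<le> Suc k"
      show "\<forall>x\<in>W. pderivs js f differentiable (at x)"
      proof (cases js rule: rev_cases)
        case Nil
        with L show ?thesis by simp
      next
        case (snoc ks i)
        with L len show ?thesis by (simp add: pderivs_snoc Suc.IH)
      qed
    qed
  next
    assume R: ?R
    have "\<forall>x\<in>W. f differentiable (at x)"
      using R[rule_format, of "[]"] by simp
    moreover have "diff_order k W (partial i f)" for i
      using R unfolding Suc.IH by (auto simp flip: pderivs_snoc)
    ultimately show ?L by simp
  qed
qed simp

lemma smooth_on_iff_diff_order: "smooth_on W f \<longleftrightarrow> (\<forall>k. diff_order k W f)"
  unfolding smooth_on_def diff_order_iff_pderivs by auto

lemma diff_order_SucD: "diff_order (Suc k) W f \<Longrightarrow> diff_order k W f"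
  unfolding diff_order_iff_pderivs by auto

lemma diff_order_subset: "diff_order k W f \<Longrightarrow> V \<subseteq> W \<Longrightarrow> diff_order k V f"
  unfolding diff_order_iff_pderivs by blast

lemma has_derivative_partial:
  assumes "(f has_derivative f') (at x)"
  shows "partial i f x = f' (axis i 1)"
  using frechet_derivative_at[OF assms] by (simp add: partial_def)

lemma has_derivative_cong_open:
  assumes "open W" "\<And>x. x \<in> W \<Longrightarrow> f x = g x" "x \<in> W"
  shows "(f has_derivative f') (at x) \<longleftrightarrow> (g has_derivative f') (at x)"
  using has_derivative_transform_within_open[of f f' x UNIV W g]
    has_derivative_transform_within_open[of g f' x UNIV W f] assms by auto

text \<open>The Frechet derivative is a choice from the set of all candidates, and this set is the same for both
  functions.\<close>

lemma frechet_derivative_cong_open: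
  assumes "open W" "\<And>x. x \<in> W \<Longrightarrow> f x = g x" "x \<in> W"
  shows "frechet_derivative f (at x) = frechet_derivative g (at x)"
  unfolding frechet_derivative_def using has_derivative_cong_open[OF assms] by simp

lemma pderivs_cong_open:
  assumes "open W" "\<And>x. x \<in> W \<Longrightarrow> f x = g x" "x \<in> W"
  shows "pderivs js f x = pderivs js g x"
  using assms(3)
proof (induction js arbitrary: x)
  case (Cons i js)
  then show ?case
    using frechet_derivative_cong_open[OF assms(1) Cons.IH] by auto
qed (simp add: assms)

lemma diff_order_cong:
  assumes "open W" "\<And>x. x \<in> W \<Longrightarrow> f x = g x" "diff_order k W f"
  shows "diff_order k W g"
proof -
  have "(pderivs js f has_derivative D) (at x) \<longleftrightarrow> (pderivs js g has_derivative D) (at x)"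
    if "x \<in> W" for js x D
    by (rule has_derivative_cong_open[OF assms(1) _ that]) (rule pderivs_cong_open[OF assms(1,2)])
  then show ?thesis
    using assms(3) unfolding diff_order_iff_pderivs differentiable_def by blast
qed

lemma diff_order_SucI:
  assumes "open W"
    and "\<And>x. x \<in> W \<Longrightarrow> f differentiable (at x)"
    and "\<And>i. diff_order k W (g i)"
    and "\<And>i x. x \<in> W \<Longrightarrow> g i x = partial i f x"
  shows "diff_order (Suc k) W f"
  using assms by (auto intro: diff_order_cong[of W "g _"])

lemma diff_order_const: "diff_order k W (\<lambda>x. c)"
  by (induction k arbitrary: c) (auto simp: partial_def)

lemma diff_order_add:
  assumes "open W"
  shows "diff_order k W f \<Longrightarrow> diff_order k W g \<Longrightarrow> diff_order k W (\<lambda>x. f x + g x)"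
proof (induction k arbitrary: f g)
  case (Suc k)
  show ?case
  proof (rule diff_order_SucI[OF assms, where g = "\<lambda>i x. partial i f x + partial i g x"])
    fix i x assume x: "x \<in> W"
    have "f differentiable (at x)" "g differentiable (at x)"
      using Suc.prems x by auto
    then have "((\<lambda>x. f x + g x) has_derivative (\<lambda>h. frechet_derivative f (at x) h +
        frechet_derivative g (at x) h)) (at x)"
      by (auto intro!: has_derivative_add simp flip: frechet_derivative_works)
    from has_derivative_partial[OF this]
    show "partial i f x + partial i g x = partial i (\<lambda>x. f x + g x) x"
      by (simp add: partial_def)
  qed (use Suc in auto)
qed simp

lemma (in bounded_bilinear) differentiable:
  assumes "f differentiable (at x)" "g differentiable (at x)"
  shows "(\<lambda>x. prod (f x) (g x)) differentiable (at x)"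
  using FDERIV[OF assms[unfolded frechet_derivative_works]] by (rule differentiableI)

lemma (in bounded_linear) differentiable:
  assumes "g differentiable (at x)"
  shows "(\<lambda>x. f (g x)) differentiable (at x)"
  using has_derivative[OF assms[unfolded frechet_derivative_works]] by (rule differentiableI)

lemma (in bounded_bilinear) diff_order_prod:
  assumes "open W"
  shows "diff_order k W f \<Longrightarrow> diff_order k W g \<Longrightarrow> diff_order k W (\<lambda>x. prod (f x) (g x))"
proof (induction k arbitrary: f g)
  case 0
  then show ?case
    unfolding diff_order.simps by (intro ballI differentiable) auto
next
  case (Suc k)
  have *: "((\<lambda>x. prod (f x) (g x)) has_derivative (\<lambda>h. prod (f x) (frechet_derivative g (at x) h) +
        prod (frechet_derivative f (at x) h) (g x))) (at x)" if "x \<in> W" for x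
    using Suc.prems that by (intro FDERIV) (auto simp flip: frechet_derivative_works)
  show ?case
  proof (rule diff_order_SucI[OF assms, where g = "\<lambda>i x. prod (f x) (partial i g x) + prod (partial i f x) (g x)"])
    fix i x assume x: "x \<in> W"
    show "prod (f x) (partial i g x) + prod (partial i f x) (g x) = partial i (\<lambda>x. prod (f x) (g x)) x"
      using has_derivative_partial[OF *[OF x]] by (simp add: partial_def)
  next
    fix x assume "x \<in> W"
    then show "(\<lambda>x. prod (f x) (g x)) differentiable (at x)"
      unfolding differentiable_def using * by blast
  next
    fix i
    show "diff_order k W (\<lambda>x. prod (f x) (partial i g x) + prod (partial i f x) (g x))"
      using Suc.prems diff_order_SucD[OF Suc.prems(1)] diff_order_SucD[OF Suc.prems(2)]
      by (intro diff_order_add[OF assms] Suc.IH) auto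
  qed
qed

lemma (in bounded_linear) partial_comp:
  assumes "g differentiable (at x)"
  shows "partial i (\<lambda>x. f (g x)) x = f (partial i g x)"
  using has_derivative_partial[OF has_derivative[OF assms[unfolded frechet_derivative_works]]]
  by (simp add: partial_def)

lemma (in bounded_linear) diff_order_comp:
  assumes "open W"
  shows "diff_order k W g \<Longrightarrow> diff_order k W (\<lambda>x. f (g x))"
proof (induction k arbitrary: g)
  case 0
  then show ?case
    unfolding diff_order.simps by (intro ballI differentiable) auto
next
  case (Suc k)
  then have "\<And>x. x \<in> W \<Longrightarrow> (\<lambda>x. f (g x)) differentiable (at x)"
    unfolding diff_order.simps by (intro differentiable) auto
  then show ?case
    using Suc by (intro diff_order_SucI[OF assms, where g = "\<lambda>i x. f (partial i g x)"])
       (auto simp: partial_comp)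
qed

lemma (in bounded_linear) pderivs_comp:
  assumes "smooth_on W g" "open W" "x \<in> W"
  shows "pderivs js (\<lambda>x. f (g x)) x = f (pderivs js g x)"
  using \<open>x \<in> W\<close>
proof (induction js arbitrary: x)
  case (Cons i js)
  have "pderivs (i # js) (\<lambda>x. f (g x)) x = partial i (\<lambda>x. f (pderivs js g x)) x"
    using frechet_derivative_cong_open[OF \<open>open W\<close> Cons.IH] Cons.prems
    by (auto simp: partial_def)
  then show ?case
    using assms Cons.prems by (auto simp: partial_comp smooth_on_def) (auto simp: partial_def)
qed simp

lemma pderivs_add:
  assumes "smooth_on W f" "smooth_on W g" "open W" "x \<in> W"
  shows "pderivs js (\<lambda>x. f x + g x) x = pderivs js f x + pderivs js g x"
  using \<open>x \<in> W\<close>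
proof (induction js arbitrary: x)
  case (Cons i js)
  have "((\<lambda>x. pderivs js f x + pderivs js g x) has_derivative
     (\<lambda>h. frechet_derivative (pderivs js f) (at x) h + frechet_derivative (pderivs js g) (at x) h)) (at x)"
    using assms Cons.prems
    by (auto intro!: has_derivative_add simp: smooth_on_def simp flip: frechet_derivative_works)
  from fun_cong[OF frechet_derivative_at[OF this], of "axis i 1"] show ?case
    using frechet_derivative_cong_open[OF \<open>open W\<close> Cons.IH Cons.prems, of "\<lambda>x. x"]
    by simp
qed simp

lemma diff_order_sum:
  assumes "open W" "\<And>i. i \<in> I \<Longrightarrow> diff_order k W (f i)"
  shows "diff_order k W (\<lambda>x. \<Sum>i\<in>I. f i x)"
  using assms(2)
  by (induction I rule: infinite_finite_induct)
    (auto intro!: diff_order_const diff_order_add[OF assms(1)])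

lemma frechet_derivative_eq_sum_partial:
  assumes "f differentiable (at x)"
  shows "frechet_derivative f (at x) h = (\<Sum>j\<in>UNIV. (h $ j) *\<^sub>R partial j f x)"
proof -
  interpret linear "frechet_derivative f (at x)"
    by (rule linear_frechet_derivative[OF assms])
  have "frechet_derivative f (at x) h = frechet_derivative f (at x) (\<Sum>j\<in>UNIV. (h $ j) *\<^sub>R axis j 1)"
    by (simp add: basis_expansion flip: scalar_mult_eq_scaleR)
  then show ?thesis
    by (simp add: sum scaleR partial_def)
qed

text \<open>By the chain rule, \<open>\<partial>\<^sub>i (f \<circ> t) = \<Sum>\<^sub>j \<partial>\<^sub>i t\<^sub>j \<cdot> (\<partial>\<^sub>j f \<circ> t)\<close>, so the induction hypothesis is needed for
  the functions \<open>\<partial>\<^sub>j f\<close> in place of \<open>f\<close>.\<close>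

lemma diff_order_compose:
  fixes t :: "real^'n::finite \<Rightarrow> real^'m::finite"
  assumes "open W" "t ` W \<subseteq> V"
  shows "diff_order k V f \<Longrightarrow> diff_order k W t \<Longrightarrow> diff_order k W (f \<circ> t)"
proof (induction k arbitrary: f)
  case 0
  then show ?case
    using assms unfolding diff_order.simps by (intro ballI differentiable_chain_at) auto
next
  case (Suc k)
  have d: "t differentiable (at x)" "f differentiable (at (t x))" if "x \<in> W" for x
    using that Suc.prems assms by auto
  show ?case
  proof (rule diff_order_SucI[OF assms(1), where g = "\<lambda>i x. \<Sum>j\<in>UNIV. (partial i t x $ j) *\<^sub>R (partial j f \<circ> t) x"])
    show "diff_order k W (\<lambda>x. \<Sum>j\<in>UNIV. (partial i t x $ j) *\<^sub>R (partial j f \<circ> t) x)" for i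
      by (intro diff_order_sum bounded_bilinear.diff_order_prod[OF bounded_bilinear_scaleR]
          bounded_linear.diff_order_comp[OF bounded_linear_vec_nth] assms Suc.IH)
        (use Suc.prems diff_order_SucD[OF Suc.prems(2)] in auto)
    show "(f \<circ> t) differentiable (at x)" if "x \<in> W" for x
      using d[OF that] by (auto intro: differentiable_chain_at)
    show "(\<Sum>j\<in>UNIV. (partial i t x $ j) *\<^sub>R (partial j f \<circ> t) x) = partial i (f \<circ> t) x" if "x \<in> W" for i x
    proof -
      have "partial i (f \<circ> t) x = frechet_derivative f (at (t x)) (partial i t x)"
        unfolding partial_def frechet_derivative_compose[OF d[OF that]] by simp
      then show ?thesis
        by (simp only: frechet_derivative_eq_sum_partial[OF d(2)[OF that]] comp_apply)
    qed
  qed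
qed

text \<open>The exponent is arbitrary in the induction because differentiation lowers it by one. Reciprocals
  (\<open>a = -1\<close>) are needed for the bump function, inverse square roots for normalising a bivector field.\<close>

lemma diff_order_powr:
  fixes g :: "real^'n::finite \<Rightarrow> real"
  assumes "open W" "\<And>x. x \<in> W \<Longrightarrow> 0 < g x"
  shows "diff_order k W g \<Longrightarrow> diff_order k W (\<lambda>x. g x powr a)"
proof (induction k arbitrary: a)
  have *: "((\<lambda>x. g x powr a) has_derivative
      (\<lambda>h. a * g x powr (a - 1) * frechet_derivative g (at x) h)) (at x)"
    if "x \<in> W" "g differentiable (at x)" for a x
  proof -
    have "((\<lambda>y. y powr a) has_derivative (*) (a * g x powr (a - 1))) (at (g x))"
      using has_real_derivative_powr[OF assms(2)[OF that(1)]] by (simp add: has_field_derivative_def)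
    from has_derivative_compose[OF that(2)[unfolded frechet_derivative_works] this] show ?thesis .
  qed
  {
    case 0
    then show ?case
      unfolding diff_order.simps using * by (auto intro: differentiableI)
  next
    case (Suc k)
    have d: "g differentiable (at x)" if "x \<in> W" for x
      using Suc.prems that by auto
    show ?case
    proof (rule diff_order_SucI[OF assms(1), where g = "\<lambda>i x. (a * g x powr (a - 1)) * partial i g x"])
      show "diff_order k W (\<lambda>x. a * g x powr (a - 1) * partial i g x)" for i
        by (intro bounded_bilinear.diff_order_prod[OF bounded_bilinear_mult]
           assms diff_order_const Suc.IH) (use Suc.prems diff_order_SucD[OF Suc.prems(1)] in auto)
      show "(\<lambda>x. g x powr a) differentiable (at x)" if "x \<in> W" for x
        using *[OF that d[OF that]] by (rule differentiableI)
      show "a * g x powr (a - 1) * partial i g x = partial i (\<lambda>x. g x powr a) x" if "x \<in> W" for i x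
        using has_derivative_partial[OF *[OF that d[OF that]]] by (simp add: partial_def)
    qed
  }
qed

lemma diff_order_ident: "diff_order k W (\<lambda>x. x)"
proof (cases k)
  case (Suc k)
  have "partial i (\<lambda>x. x) = (\<lambda>x. axis i 1)" for i :: 'a
    by (simp add: partial_def)
  then show ?thesis using Suc by (simp add: diff_order_const)
qed simp

lemma smooth_on_sum:
  assumes "open W" "\<And>i. i \<in> I \<Longrightarrow> smooth_on W (f i)"
  shows "smooth_on W (\<lambda>x. \<Sum>i\<in>I. f i x)"
  using assms by (auto simp: smooth_on_iff_diff_order intro!: diff_order_sum)

lemma smooth_on_add: "open W \<Longrightarrow> smooth_on W f \<Longrightarrow> smooth_on W g \<Longrightarrow> smooth_on W (\<lambda>x. f x + g x)"
  by (auto simp: smooth_on_iff_diff_order intro!: diff_order_add)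

lemma smooth_on_cong: "open W \<Longrightarrow> (\<And>x. x \<in> W \<Longrightarrow> f x = g x) \<Longrightarrow> smooth_on W f \<Longrightarrow> smooth_on W g"
  by (auto simp: smooth_on_iff_diff_order intro: diff_order_cong)

lemma smooth_on_subset: "smooth_on W f \<Longrightarrow> V \<subseteq> W \<Longrightarrow> smooth_on V f"
  by (auto simp: smooth_on_iff_diff_order intro: diff_order_subset)

lemma smooth_on_const: "smooth_on W (\<lambda>x. c)"
  by (auto simp: smooth_on_iff_diff_order diff_order_const)

lemma (in bounded_linear) smooth_on_comp: "open W \<Longrightarrow> smooth_on W g \<Longrightarrow> smooth_on W (\<lambda>x. f (g x))"
  by (auto simp: smooth_on_iff_diff_order intro!: diff_order_comp)

lemma (in bounded_bilinear) smooth_on_prod: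
  "open W \<Longrightarrow> smooth_on W f \<Longrightarrow> smooth_on W g \<Longrightarrow> smooth_on W (\<lambda>x. prod (f x) (g x))"
  by (auto simp: smooth_on_iff_diff_order intro!: diff_order_prod)

lemma smooth_on_compose:
  fixes t :: "real^'n::finite \<Rightarrow> real^'m::finite"
  assumes "open W" "t ` W \<subseteq> V" "smooth_on V f" "smooth_on W t"
  shows "smooth_on W (f \<circ> t)"
  using assms(3,4) unfolding smooth_on_iff_diff_order
  by (intro allI diff_order_compose[OF assms(1,2)]) auto

lemma smooth_on_pderivs:
  "smooth_on W f \<Longrightarrow> smooth_on W (pderivs js f)"
proof -
  have "pderivs ks (pderivs js f) = pderivs (ks @ js) f" for ks
    by (induction ks) auto
  then show "smooth_on W f \<Longrightarrow> smooth_on W (pderivs js f)"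
    by (simp add: smooth_on_def)
qed

lemma smooth_on_imp_differentiable: "smooth_on W f \<Longrightarrow> x \<in> W \<Longrightarrow> f differentiable (at x)"
  unfolding smooth_on_def by (metis pderivs.simps(1))

lemma smooth_on_imp_continuous_on: "smooth_on W f \<Longrightarrow> continuous_on W f"
  by (meson continuous_at_imp_continuous_on differentiable_imp_continuous_within smooth_on_imp_differentiable)

lemma smooth_on_Un: "smooth_on V f \<Longrightarrow> smooth_on W f \<Longrightarrow> smooth_on (V \<union> W) f"
  by (auto simp: smooth_on_def)

lemma pderivs_sum:
  assumes "\<And>i. i \<in> I \<Longrightarrow> smooth_on W (f i)" "open W" "x \<in> W"
  shows "pderivs js (\<lambda>x. \<Sum>i\<in>I. f i x) x = (\<Sum>i\<in>I. pderivs js (f i) x)"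
proof -
  have 0: "pderivs js (\<lambda>x. 0) = (\<lambda>x. 0)"
    by (induction js) auto
  show ?thesis
    using assms(1)
    by (induction I rule: infinite_finite_induct)
      (auto simp: 0 pderivs_add[OF _ _ assms(2,3)] smooth_on_sum assms(2))
qed

section \<open>Bump functions\<close>

text \<open>The classical flat function \<open>exp (- 1 / t)\<close> at \<open>n = 0\<close>. The extra factor \<open>1 / t\<^sup>n\<close> gives a family that is closed
  under differentiation, up to linear combinations; its members vanish at \<open>0\<close> together with their
  difference quotients.\<close>

definition flat_fun :: "nat \<Rightarrow> real \<Rightarrow> real" where
  "flat_fun n t = (if 0 < t then exp (- inverse t) * inverse t ^ n else 0)"

lemma flat_fun_tendsto_0: "(flat_fun n \<longlongrightarrow> 0) (at 0)"
proof -
  have "((\<lambda>y::real. y ^ n / exp y) \<longlongrightarrow> 0) at_top"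
    by (rule tendsto_power_div_exp_0)
  then have "((\<lambda>t::real. inverse t ^ n / exp (inverse t)) \<longlongrightarrow> 0) (at_right 0)"
    by (rule filterlim_compose[OF _ filterlim_inverse_at_top_right])
  then have "(flat_fun n \<longlongrightarrow> 0) (at_right 0)"
    by (rule Lim_transform_eventually)
       (auto simp: eventually_at_right_field flat_fun_def exp_minus field_simps intro!: exI[of _ 1])
  moreover have "(flat_fun n \<longlongrightarrow> 0) (at_left 0)"
    by (rule Lim_transform_eventually[OF tendsto_const])
      (auto simp: eventually_at_left_field flat_fun_def intro!: exI[of _ "-1"])
  ultimately show ?thesis
    by (simp add: filterlim_split_at)
qed

lemma flat_fun_deriv:
  "(flat_fun n has_real_derivative flat_fun (n + 2) t - real n * flat_fun (n + 1) t) (at t)"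
proof -
  consider "t > 0" | "t < 0" | "t = 0" by linarith
  then show ?thesis
  proof cases
    case 1
    define y where "y = inverse t"
    have "((\<lambda>t. exp (- inverse t) * inverse t ^ n) has_real_derivative
        exp (- y) * y\<^sup>2 * y ^ n + exp (- y) * (real n * y ^ (n - 1) * (- y\<^sup>2))) (at t)"
      using 1 by (auto intro!: derivative_eq_intros simp: y_def power2_eq_square)
    moreover have "exp (- y) * y\<^sup>2 * y ^ n + exp (- y) * (real n * y ^ (n - 1) * (- y\<^sup>2)) =
        exp (- y) * y ^ (n + 2) - real n * (exp (- y) * y ^ (n + 1))"
      by (cases n) (simp_all add: power2_eq_square algebra_simps)
    ultimately have "((\<lambda>t. exp (- inverse t) * inverse t ^ n) has_real_derivative
        flat_fun (n + 2) t - real n * flat_fun (n + 1) t) (at t)"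
      using 1 by (simp add: flat_fun_def y_def)
    then show ?thesis
      by (rule has_field_derivative_transform_within_open[where S = "{0<..}"])
        (use 1 in \<open>auto simp: flat_fun_def\<close>)
  next
    case 2
    have "((\<lambda>t. 0) has_real_derivative flat_fun (n + 2) t - real n * flat_fun (n + 1) t) (at t)"
      using 2 by (auto simp: flat_fun_def)
    then show ?thesis
      by (rule has_field_derivative_transform_within_open[where S = "{..<0}"])
        (use 2 in \<open>auto simp: flat_fun_def\<close>)
  next
    case 3
    \<comment> \<open>The difference quotient of \<open>flat_fun n\<close> at 0 is \<open>flat_fun (Suc n)\<close>.\<close>
    have "((\<lambda>t. (flat_fun n t - flat_fun n 0) / (t - 0)) \<longlongrightarrow> 0) (at 0)"
      by (rule Lim_transform_eventually[OF flat_fun_tendsto_0[of "Suc n"]])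
        (auto simp: flat_fun_def divide_inverse eventually_at_filter)
    with 3 show ?thesis
      by (simp add: has_field_derivative_iff flat_fun_def)
  qed
qed

lemma diff_order_flat_fun:
  fixes g :: "real^'n::finite \<Rightarrow> real"
  assumes "open W"
  shows "diff_order k W g \<Longrightarrow> diff_order k W (\<lambda>x. flat_fun n (g x))"
proof (induction k arbitrary: n)
  have *: "((\<lambda>x. flat_fun n (g x)) has_derivative
      (\<lambda>h. (flat_fun (n + 2) (g x) - real n * flat_fun (n + 1) (g x)) * frechet_derivative g (at x) h)) (at x)"
    if "g differentiable (at x)" for n x
    using has_derivative_compose[OF _ flat_fun_deriv[unfolded has_field_derivative_def]] that
    by (simp add: frechet_derivative_works)
  {
    case 0
    then show ?case
      unfolding diff_order.simps using * by (auto intro: differentiableI)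
  next
    case (Suc k)
    have d: "g differentiable (at x)" if "x \<in> W" for x
      using Suc.prems that by auto
    show ?case
    proof (rule diff_order_SucI[OF assms(1), where g = "\<lambda>i x. (flat_fun (n + 2) (g x) + (- real n) * flat_fun (n + 1) (g x)) * partial i g x"])
      show "diff_order k W (\<lambda>x. (flat_fun (n + 2) (g x) + (- real n) * flat_fun (n + 1) (g x)) * partial i g x)" for i
        by (intro bounded_bilinear.diff_order_prod[OF bounded_bilinear_mult] diff_order_add
           assms diff_order_const Suc.IH) (use Suc.prems diff_order_SucD[OF Suc.prems(1)] in auto)
      show "(\<lambda>x. flat_fun n (g x)) differentiable (at x)" if "x \<in> W" for x
        using *[OF d[OF that]] by (rule differentiableI)
      show "(flat_fun (n + 2) (g x) + (- real n) * flat_fun (n + 1) (g x)) * partial i g x = partial i (\<lambda>x. flat_fun n (g x)) x" if "x \<in> W" for i x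
        using has_derivative_partial[OF *[OF d[OF that]]] by (simp add: partial_def)
    qed
  }
qed

text \<open>The usual quotient \<open>a / (a + b)\<close>, where \<open>a\<close> is positive exactly inside the disc of radius \<open>2 r\<close>
  and \<open>b\<close> exactly outside the disc of radius \<open>r\<close>, so that \<open>a + b\<close> has no zero.\<close>

definition bump :: "real^2 \<Rightarrow> real \<Rightarrow> real^2 \<Rightarrow> real" where
  "bump z r x = (let a = flat_fun 0 (4 * r\<^sup>2 - (x - z) \<bullet> (x - z)); b = flat_fun 0 ((x - z) \<bullet> (x - z) - r\<^sup>2)
     in a * (a + b) powr -1)"

lemma smooth_on_bump:
  assumes "r > 0"
  shows "smooth_on UNIV (bump z r)"
proof -
  have q: "diff_order k UNIV (\<lambda>x. (x - z) \<bullet> (x - z))" for k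
    using diff_order_add[OF open_UNIV diff_order_ident diff_order_const[of _ _ "- z"]]
    by (intro bounded_bilinear.diff_order_prod[OF bounded_bilinear_inner] open_UNIV) simp_all
  have a: "diff_order k UNIV (\<lambda>x. flat_fun 0 (4 * r\<^sup>2 - (x - z) \<bullet> (x - z)))" for k
  proof (rule diff_order_flat_fun[OF open_UNIV])
    have "diff_order k UNIV (\<lambda>x. 4 * r\<^sup>2 + - 1 * ((x - z) \<bullet> (x - z)))"
      by (intro diff_order_add bounded_bilinear.diff_order_prod[OF bounded_bilinear_mult] open_UNIV diff_order_const q)
    then show "diff_order k UNIV (\<lambda>x. 4 * r\<^sup>2 - (x - z) \<bullet> (x - z))" by simp
  qed
  have b: "diff_order k UNIV (\<lambda>x. flat_fun 0 ((x - z) \<bullet> (x - z) - r\<^sup>2))" for k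
  proof (rule diff_order_flat_fun[OF open_UNIV])
    have "diff_order k UNIV (\<lambda>x. (x - z) \<bullet> (x - z) + - (r\<^sup>2))"
      by (intro diff_order_add open_UNIV diff_order_const q)
    then show "diff_order k UNIV (\<lambda>x. (x - z) \<bullet> (x - z) - r\<^sup>2)" by simp
  qed
  have pos: "flat_fun 0 (4 * r\<^sup>2 - t) + flat_fun 0 (t - r\<^sup>2) > 0" for t
  proof -
    have "0 < r\<^sup>2" using assms by simp
    then have "4 * r\<^sup>2 - t > 0 \<or> t - r\<^sup>2 > 0" by linarith
    then show ?thesis
      by (auto simp: flat_fun_def intro: add_pos_nonneg)
  qed
  show ?thesis
    unfolding bump_def Let_def smooth_on_iff_diff_order
    by (intro allI bounded_bilinear.diff_order_prod[OF bounded_bilinear_mult] open_UNIV a diff_order_powr diff_order_add b pos)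
qed

lemma bump_eq_1: "r > 0 \<Longrightarrow> x \<in> ball z r \<Longrightarrow> bump z r x = 1"
proof -
  assume "r > 0" "x \<in> ball z r"
  then have "(x - z) \<bullet> (x - z) < r\<^sup>2"
    by (metis dist_commute dist_norm mem_ball norm_ge_zero power2_norm_eq_inner power_strict_mono zero_less_numeral)
  moreover from this have "(x - z) \<bullet> (x - z) < 4 * r\<^sup>2"
    using zero_le_power2[of r] by linarith
  ultimately show ?thesis
    by (auto simp: bump_def Let_def flat_fun_def powr_minus)
qed

lemma bump_eq_0: "r > 0 \<Longrightarrow> x \<notin> cball z (2 * r) \<Longrightarrow> bump z r x = 0"
proof -
  assume r: "r > 0" "x \<notin> cball z (2 * r)"
  then have "(2 * r)\<^sup>2 < (norm (x - z))\<^sup>2"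
    by (intro power_strict_mono) (auto simp: dist_norm norm_minus_commute)
  then have "(x - z) \<bullet> (x - z) > 4 * r\<^sup>2"
    by (simp add: power2_norm_eq_inner)
  then show ?thesis
    by (auto simp: bump_def Let_def flat_fun_def powr_minus)
qed

section \<open>Charts and transition maps\<close>

locale surface =
  fixes M :: "'a topology" and A :: "'a chart set"
  assumes surface: "closed_oriented_surface M A"
begin

lemma Hausdorff: "Hausdorff_space M" and compact: "compact_space M"
  and chart: "c \<in> A \<Longrightarrow> is_chart M c" and cover: "(\<Union>c\<in>A. fst c) = topspace M"
  and compatible: "c \<in> A \<Longrightarrow> d \<in> A \<Longrightarrow> oriented_compatible c d"
  using surface by (auto simp: closed_oriented_surface_def)

context
  fixes c assumes c: "c \<in> A"
begin

lemma openin_chart_domain: "openin M (fst c)" and open_chart_image: "open (snd c ` fst c)"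
  and homeo: "homeomorphic_map (subtopology M (fst c)) (top_of_set (snd c ` fst c)) (snd c)"
  using chart[OF c] by (auto simp: is_chart_def)

lemma chart_domain_subset: "fst c \<subseteq> topspace M"
  using openin_chart_domain by (rule openin_subset)

lemma topspace_chart: "topspace (subtopology M (fst c)) = fst c"
  using chart_domain_subset by auto

lemma chart_inj: "inj_on (snd c) (fst c)"
  using homeomorphic_imp_injective_map[OF homeo] unfolding topspace_chart .

lemma chart_inv_chart: "p \<in> fst c \<Longrightarrow> chart_inv c (snd c p) = p"
  using chart_inj by simp

lemma open_image_chart:
  assumes "openin M V"
  shows "open (snd c ` (fst c \<inter> V))"
proof -
  have "openin (subtopology M (fst c)) (fst c \<inter> V)"
    using assms by (auto simp: openin_subtopology_Int2)
  then have "openin (top_of_set (snd c ` fst c)) (snd c ` (fst c \<inter> V))"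
    using homeomorphic_imp_open_map[OF homeo] by (auto simp: open_map_def)
  then show ?thesis
    using open_chart_image openin_open_trans by blast
qed

lemma compact_image_chart:
  assumes "compactin M K" "K \<subseteq> fst c"
  shows "compact (snd c ` K)"
proof -
  have "compactin (subtopology M (fst c)) K"
    using assms by (simp add: compactin_subtopology)
  then have "compactin (top_of_set (snd c ` fst c)) (snd c ` K)"
    by (rule image_compactin[OF _ homeomorphic_imp_continuous_map[OF homeo]])
  then show ?thesis
    by (simp add: compactin_subtopology)
qed

lemma openin_vimage_chart:
  assumes "open B"
  shows "openin M {p \<in> fst c. snd c p \<in> B}"
proof -
  have "openin (top_of_set (snd c ` fst c)) (snd c ` fst c \<inter> B)"
    using assms by (rule openin_open_Int)
  then have "openin (subtopology M (fst c)) {p \<in> topspace (subtopology M (fst c)). snd c p \<in> snd c ` fst c \<inter> B}"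
    by (rule openin_continuous_map_preimage[OF homeomorphic_imp_continuous_map[OF homeo]])
  then have "openin M {p \<in> topspace (subtopology M (fst c)). snd c p \<in> snd c ` fst c \<inter> B}"
    using openin_chart_domain openin_trans_full by blast
  moreover have "{p \<in> topspace (subtopology M (fst c)). snd c p \<in> snd c ` fst c \<inter> B} = {p \<in> fst c. snd c p \<in> B}"
    unfolding topspace_chart by auto
  ultimately show ?thesis by simp
qed

lemma compactin_chart_inv:
  assumes "compact C" "C \<subseteq> snd c ` fst c"
  shows "compactin M (chart_inv c ` C)"
proof -
  have hm: "homeomorphic_maps (subtopology M (fst c)) (top_of_set (snd c ` fst c)) (snd c) (chart_inv c)"
  proof -
    obtain g where g: "homeomorphic_maps (subtopology M (fst c)) (top_of_set (snd c ` fst c)) (snd c) g"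
      using homeo homeomorphic_map_maps by blast
    have "g x = chart_inv c x" if "x \<in> snd c ` fst c" for x
      using g that chart_domain_subset by (auto simp: homeomorphic_maps_def chart_inv_chart)
    then show ?thesis
      using g homeomorphic_maps_eq[of _ _ "snd c" g] by (metis (full_types) topspace_euclidean_subtopology)
  qed
  then have "continuous_map (top_of_set (snd c ` fst c)) (subtopology M (fst c)) (chart_inv c)"
    by (auto simp: homeomorphic_maps_def)
  moreover have "compactin (top_of_set (snd c ` fst c)) C"
    using assms by (simp add: compactin_subtopology)
  ultimately have "compactin (subtopology M (fst c)) (chart_inv c ` C)"
    by (rule image_compactin[rotated])
  then show ?thesis
    by (simp add: compactin_subtopology)
qed

lemma smooth_maps_chart: "f \<in> smooth_maps M A \<Longrightarrow> smooth_on (snd c ` fst c) (f \<circ> chart_inv c)"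
  using c by (simp add: smooth_maps_def)

end

definition transition :: "'a chart \<Rightarrow> 'a chart \<Rightarrow> real^2 \<Rightarrow> real^2" where
  "transition c d = snd d \<circ> chart_inv c"

context
  fixes c d assumes c: "c \<in> A" and d: "d \<in> A"
begin

abbreviation (input) "overlap \<equiv> snd c ` (fst c \<inter> fst d)"

lemma open_overlap: "open overlap"
  using open_image_chart[OF c openin_chart_domain[OF d]] .

lemma transition_smooth: "smooth_on overlap (transition c d)"
  and transition_det: "x \<in> overlap \<Longrightarrow> 0 < det (matrix (frechet_derivative (transition c d) (at x)))"
  using compatible[OF c d] by (auto simp: oriented_compatible_def Let_def transition_def)

lemma transition_chart: "p \<in> fst c \<Longrightarrow> transition c d (snd c p) = snd d p"
  by (simp add: transition_def chart_inv_chart[OF c])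

lemma compose_transition: "x \<in> overlap \<Longrightarrow> (f \<circ> chart_inv c) x = ((f \<circ> chart_inv d) \<circ> transition c d) x"
  by (auto simp: transition_def chart_inv_chart c d)

lemma chart_deriv_transition:
  assumes "f \<in> smooth_maps M A" "p \<in> fst c" "p \<in> fst d"
  shows "chart_deriv c f p = chart_deriv d f p \<circ> frechet_derivative (transition c d) (at (snd c p))"
proof -
  have p: "snd c p \<in> overlap" using assms by auto
  have "chart_deriv c f p = frechet_derivative ((f \<circ> chart_inv d) \<circ> transition c d) (at (snd c p))"
    unfolding chart_deriv_def
    using frechet_derivative_cong_open[OF open_overlap compose_transition p] .
  also have "\<dots> = chart_deriv d f p \<circ> frechet_derivative (transition c d) (at (snd c p))"
    unfolding chart_deriv_def transition_chart[OF assms(2), symmetric]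
    by (rule frechet_derivative_compose)
      (use smooth_on_imp_differentiable[OF transition_smooth p]
        smooth_on_imp_differentiable[OF smooth_maps_chart[OF d assms(1)]] assms
       in \<open>auto simp: transition_chart\<close>)
  finally show ?thesis .
qed

lemma transition_deriv_bij:
  assumes "x \<in> overlap"
  shows "linear (frechet_derivative (transition c d) (at x))" "bij (frechet_derivative (transition c d) (at x))"
proof -
  show l: "linear (frechet_derivative (transition c d) (at x))"
    by (rule linear_frechet_derivative[OF smooth_on_imp_differentiable[OF transition_smooth assms]])
  have "det (matrix (frechet_derivative (transition c d) (at x))) \<noteq> 0"
    using transition_det[OF assms] by simp
  then have "inj (frechet_derivative (transition c d) (at x))"
    using l by (simp add: det_nz_iff_inj)
  then show "bij (frechet_derivative (transition c d) (at x))"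
    using l by (simp add: bij_def linear_injective_imp_surjective)
qed

text \<open>Being an immersion at \<open>p\<close> may therefore be tested in any one chart around \<open>p\<close>, which reduces the
  condition over all charts of the atlas to finitely many compact pieces.\<close>

lemma inj_chart_deriv_transition:
  assumes "f \<in> smooth_maps M A" "p \<in> fst c" "p \<in> fst d"
  shows "inj (chart_deriv c f p) \<longleftrightarrow> inj (chart_deriv d f p)"
proof -
  have "bij (frechet_derivative (transition c d) (at (snd c p)))"
    using assms by (intro transition_deriv_bij) auto
  then show ?thesis
    unfolding chart_deriv_transition[OF assms]
    by (metis bij_is_inj bij_is_surj inj_compose inj_on_imageI2 inj_on_imageI)
qed

end

end

section \<open>Two-jets and the Whitney topology\<close>

text \<open>Both mixed derivatives are recorded; adding a quadratic polynomial shifts them by the same amount.\<close>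

definition jet2 :: "(real^2 \<Rightarrow> 'b::real_normed_vector) \<Rightarrow> real^2 \<Rightarrow> 'b \<times> 'b \<times> 'b \<times> 'b \<times> 'b \<times> 'b" where
  "jet2 F x = (pderivs [1] F x, pderivs [2] F x,
     pderivs [1, 1] F x, pderivs [1, 2] F x, pderivs [2, 1] F x, pderivs [2, 2] F x)"

lemma continuous_on_jet2:
  assumes "smooth_on W F"
  shows "continuous_on W (jet2 F)"
  unfolding jet2_def
  by (intro continuous_on_Pair smooth_on_imp_continuous_on smooth_on_pderivs assms)

lemma norm_6_le: "norm (a, b, c, d, e, f) \<le> norm a + norm b + norm c + norm d + norm e + norm f"
proof -
  have "norm (a, b, c, d, e, f) \<le> norm a + (norm b + (norm c + (norm d + (norm e + norm f))))"
    by (intro order_trans[OF norm_Pair_le] add_left_mono order_refl)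
  then show ?thesis by simp
qed

lemma jet2_close:
  assumes "\<And>js. length js \<le> 2 \<Longrightarrow> norm (pderivs js G x - pderivs js F x) < e / 6"
  shows "dist (jet2 F x) (jet2 G x) < e"
proof -
  have "dist (jet2 F x) (jet2 G x) \<le> norm (pderivs [1] G x - pderivs [1] F x) + norm (pderivs [2] G x - pderivs [2] F x)
     + norm (pderivs [1, 1] G x - pderivs [1, 1] F x) + norm (pderivs [1, 2] G x - pderivs [1, 2] F x)
     + norm (pderivs [2, 1] G x - pderivs [2, 1] F x) + norm (pderivs [2, 2] G x - pderivs [2, 2] F x)"
    by (subst dist_commute) (simp only: dist_norm jet2_def diff_Pair norm_6_le)
  also have "\<dots> < e / 6 + e / 6 + e / 6 + e / 6 + e / 6 + e / 6"
    by (intro add_strict_mono assms) auto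
  finally show ?thesis by simp
qed

context surface
begin

lemma topspace_whitney: "topspace (whitney_topology M A :: ('a \<Rightarrow> 'b::real_normed_vector) topology) = smooth_maps M A"
  unfolding whitney_topology_def topology_generated_by_topspace
  by (auto simp: jet_nbhd_def)

lemma openin_jet_nbhd:
  assumes "f \<in> smooth_maps M A" "c \<in> A" "compactin M K" "K \<subseteq> fst c" "0 < \<epsilon>"
  shows "openin (whitney_topology M A) (jet_nbhd M A f c K k \<epsilon>)"
  unfolding whitney_topology_def using assms by (intro topology_generated_by_Basis) blast

text \<open>The 2-jets of \<open>f\<close> over the compact set \<open>K\<close> form a compact subset of \<open>G\<close>, which thus has a
  uniform distance from the complement of \<open>G\<close>.\<close>

lemma openin_whitney_jet2:
  assumes "open G" "c \<in> A" "compactin M K" "K \<subseteq> fst c"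
  shows "openin (whitney_topology M A) {f \<in> smooth_maps M A. \<forall>p\<in>K. jet2 (f \<circ> chart_inv c) (snd c p) \<in> G}"
    (is "openin _ ?S")
proof (subst openin_subopen, intro ballI)
  fix f assume f: "f \<in> ?S"
  have "compact (jet2 (f \<circ> chart_inv c) ` snd c ` K)"
  proof (intro compact_continuous_image compact_image_chart assms continuous_on_jet2)
    show "smooth_on (snd c ` K) (f \<circ> chart_inv c)"
      using f assms by (intro smooth_on_subset[OF smooth_maps_chart[OF assms(2), of f]]) auto
  qed
  moreover have "jet2 (f \<circ> chart_inv c) ` snd c ` K \<subseteq> G"
    using f by auto
  ultimately obtain e where e: "e > 0" "(\<Union>J\<in>jet2 (f \<circ> chart_inv c) ` snd c ` K. ball J e) \<subseteq> G"
    using compact_subset_open_imp_ball_epsilon_subset[OF _ assms(1)] by metis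
  have "jet_nbhd M A f c K 2 (e / 6) \<subseteq> ?S"
  proof
    fix g assume g: "g \<in> jet_nbhd M A f c K 2 (e / 6)"
    have "jet2 (g \<circ> chart_inv c) (snd c p) \<in> G" if "p \<in> K" for p
    proof -
      have "dist (jet2 (f \<circ> chart_inv c) (snd c p)) (jet2 (g \<circ> chart_inv c) (snd c p)) < e"
        using g that by (intro jet2_close) (auto simp: jet_nbhd_def)
      then show ?thesis using e(2) that by fastforce
    qed
    then show "g \<in> ?S" using g by (auto simp: jet_nbhd_def)
  qed
  moreover have "f \<in> jet_nbhd M A f c K 2 (e / 6)"
    using f e(1) by (auto simp: jet_nbhd_def)
  moreover have "openin (whitney_topology M A) (jet_nbhd M A f c K 2 (e / 6))"
    using f e(1) assms by (intro openin_jet_nbhd) auto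
  ultimately show "\<exists>T. openin (whitney_topology M A) T \<and> f \<in> T \<and> T \<subseteq> ?S"
    by blast
qed

text \<open>A basic neighbourhood of \<open>f0\<close> is centred at some other map \<open>f\<close>. The distance of the
  derivatives of \<open>f0\<close> and \<open>f\<close> attains its maximum over \<open>K\<close>, and this maximum leaves room below \<open>\<epsilon>\<close>.\<close>

lemma limitin_whitney:
  fixes f0 :: "'a \<Rightarrow> 'b::real_normed_vector"
  assumes f0: "f0 \<in> smooth_maps M A" and fs: "\<And>s. fs s \<in> smooth_maps M A"
    and conv: "\<And>c K js \<epsilon>. c \<in> A \<Longrightarrow> compactin M K \<Longrightarrow> K \<subseteq> fst c \<Longrightarrow> 0 < \<epsilon> \<Longrightarrow>
       eventually (\<lambda>s. \<forall>p\<in>K. norm (pderivs js (fs s \<circ> chart_inv c) (snd c p)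
         - pderivs js (f0 \<circ> chart_inv c) (snd c p)) < \<epsilon>) F"
  shows "limitin (whitney_topology M A) fs f0 F"
  unfolding limitin_def topspace_whitney
proof (intro conjI allI impI f0, elim conjE)
  fix T assume "openin (whitney_topology M A) T" "f0 \<in> T"
  then have "generate_topology_on (insert (smooth_maps M A)
     {jet_nbhd M A f c K k \<epsilon> | f c K k \<epsilon>.
        f \<in> smooth_maps M A \<and> c \<in> A \<and> compactin M K \<and> K \<subseteq> fst c \<and> 0 < \<epsilon>}) T"
    by (simp add: whitney_topology_def openin_topology_generated_by_iff)
  then show "eventually (\<lambda>s. fs s \<in> T) F"
    using \<open>f0 \<in> T\<close>
  proof (induction T)
    case (Int S T)
    then show ?case by (auto intro: eventually_conj)
  next
    case (UN \<T>)
    then obtain T where "T \<in> \<T>" "f0 \<in> T" "eventually (\<lambda>s. fs s \<in> T) F" by auto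
    then show ?case by (auto elim: eventually_mono)
  next
    case (Basis T)
    show ?case
    proof (cases "T = smooth_maps M A")
      case False
      then obtain f c K k \<epsilon> where T: "T = jet_nbhd M A f c K k \<epsilon>" and f: "f \<in> smooth_maps M A"
        and c: "c \<in> A" and K: "compactin M K" "K \<subseteq> fst c" and "0 < \<epsilon>"
        using Basis.hyps by blast
      have "eventually (\<lambda>s. \<forall>p\<in>K. norm (pderivs js (fs s \<circ> chart_inv c) (snd c p)
         - pderivs js (f \<circ> chart_inv c) (snd c p)) < \<epsilon>) F" if js: "length js \<le> k" for js
      proof (cases "K = {}")
        case False
        let ?h = "\<lambda>x. norm (pderivs js (f0 \<circ> chart_inv c) x - pderivs js (f \<circ> chart_inv c) x)"
        have "continuous_on (snd c ` K) ?h"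
          using K smooth_maps_chart[OF c f0] smooth_maps_chart[OF c f]
          by (intro continuous_intros smooth_on_imp_continuous_on smooth_on_pderivs)
            (auto intro!: smooth_on_subset[where W = "snd c ` fst c"])
        then obtain q where q: "q \<in> K" "\<And>p. p \<in> K \<Longrightarrow> ?h (snd c p) \<le> ?h (snd c q)"
          using continuous_attains_sup[OF compact_image_chart[OF c K], of ?h] False by auto
        have "?h (snd c q) < \<epsilon>"
          using Basis.prems q(1) js unfolding T jet_nbhd_def by auto
        then have "eventually (\<lambda>s. \<forall>p\<in>K. norm (pderivs js (fs s \<circ> chart_inv c) (snd c p)
         - pderivs js (f0 \<circ> chart_inv c) (snd c p)) < \<epsilon> - ?h (snd c q)) F"
          by (intro conv c K) simp
        then show ?thesis
        proof (rule eventually_mono, intro ballI)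
          fix s p
          assume *: "\<forall>p\<in>K. norm (pderivs js (fs s \<circ> chart_inv c) (snd c p)
            - pderivs js (f0 \<circ> chart_inv c) (snd c p)) < \<epsilon> - ?h (snd c q)" and p: "p \<in> K"
          have "norm (pderivs js (fs s \<circ> chart_inv c) (snd c p) - pderivs js (f \<circ> chart_inv c) (snd c p))
            \<le> norm (pderivs js (fs s \<circ> chart_inv c) (snd c p) - pderivs js (f0 \<circ> chart_inv c) (snd c p)) + ?h (snd c p)"
            by (rule order_trans[OF _ norm_triangle_ineq]) simp
          then show "norm (pderivs js (fs s \<circ> chart_inv c) (snd c p) - pderivs js (f \<circ> chart_inv c) (snd c p)) < \<epsilon>"
            using bspec[OF * p] q(2)[OF p] by linarith
        qed
      qed auto
      then have "eventually (\<lambda>s. \<forall>js\<in>{js. length js \<le> k}. \<forall>p\<in>K. norm (pderivs js (fs s \<circ> chart_inv c) (snd c p)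
         - pderivs js (f \<circ> chart_inv c) (snd c p)) < \<epsilon>) F"
        using finite_lists_length_le[OF finite[of "UNIV :: 2 set"], of k]
        by (intro eventually_ball_finite) auto
      then show ?thesis
        unfolding T jet_nbhd_def using fs by (auto elim: eventually_mono)
    qed (use fs in auto)
  qed auto
qed

definition perturb :: "('a \<Rightarrow> 'b) \<Rightarrow> 'i set \<Rightarrow> ('i \<Rightarrow> 'a \<Rightarrow> real) \<Rightarrow> ('i \<Rightarrow> 'b) \<Rightarrow> 'a \<Rightarrow> 'b::real_normed_vector" where
  "perturb f I \<beta> v = (\<lambda>p\<in>topspace M. f p + (\<Sum>i\<in>I. \<beta> i p *\<^sub>R v i))"

lemma perturb_chart:
  assumes "c \<in> A" "x \<in> snd c ` fst c"
  shows "(perturb f I \<beta> v \<circ> chart_inv c) x =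
     (f \<circ> chart_inv c) x + (\<Sum>i\<in>I. (\<beta> i \<circ> chart_inv c) x *\<^sub>R v i)"
proof -
  obtain p where "p \<in> fst c" "x = snd c p" using assms(2) by blast
  then show ?thesis
    using chart_domain_subset[OF assms(1)] by (auto simp: perturb_def chart_inv_chart[OF assms(1)])
qed

context
  fixes f :: "'a \<Rightarrow> 'b::real_normed_vector" and I :: "'i set" and \<beta> :: "'i \<Rightarrow> 'a \<Rightarrow> real"
  assumes f: "f \<in> smooth_maps M A" and \<beta>: "\<And>i. i \<in> I \<Longrightarrow> \<beta> i \<in> smooth_maps M A"
begin

lemma smooth_on_perturb_sum:
  assumes "c \<in> A"
  shows "i \<in> I \<Longrightarrow> smooth_on (snd c ` fst c) (\<lambda>x. (\<beta> i \<circ> chart_inv c) x *\<^sub>R w)"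
   and "smooth_on (snd c ` fst c) (\<lambda>x. \<Sum>i\<in>I. (\<beta> i \<circ> chart_inv c) x *\<^sub>R v i)"
proof -
  show *: "smooth_on (snd c ` fst c) (\<lambda>x. (\<beta> i \<circ> chart_inv c) x *\<^sub>R w)" if "i \<in> I" for i w
    by (rule bounded_linear.smooth_on_comp[OF bounded_linear_scaleR_left open_chart_image[OF assms]
        smooth_maps_chart[OF assms \<beta>[OF that]]])
  show "smooth_on (snd c ` fst c) (\<lambda>x. \<Sum>i\<in>I. (\<beta> i \<circ> chart_inv c) x *\<^sub>R v i)"
    by (intro smooth_on_sum * open_chart_image assms)
qed

lemma perturb_smooth: "perturb f I \<beta> v \<in> smooth_maps M A"
proof -
  have "smooth_on (snd c ` fst c) (perturb f I \<beta> v \<circ> chart_inv c)" if c: "c \<in> A" for c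
    by (rule smooth_on_cong[OF open_chart_image[OF c]])
      (use c in \<open>auto simp: perturb_chart simp del: comp_apply intro!: smooth_on_add smooth_on_perturb_sum
         open_chart_image smooth_maps_chart f\<close>)
  then show ?thesis
    by (auto simp: smooth_maps_def perturb_def)
qed

lemma pderivs_perturb:
  assumes c: "c \<in> A" and x: "x \<in> snd c ` fst c"
  shows "pderivs js (perturb f I \<beta> v \<circ> chart_inv c) x =
    pderivs js (f \<circ> chart_inv c) x + (\<Sum>i\<in>I. pderivs js (\<beta> i \<circ> chart_inv c) x *\<^sub>R v i)"
proof -
  have "pderivs js (perturb f I \<beta> v \<circ> chart_inv c) x =
     pderivs js (\<lambda>x. (f \<circ> chart_inv c) x + (\<Sum>i\<in>I. (\<beta> i \<circ> chart_inv c) x *\<^sub>R v i)) x"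
    using perturb_chart[OF c] by (rule pderivs_cong_open[OF open_chart_image[OF c] _ x])
  also have "\<dots> = pderivs js (f \<circ> chart_inv c) x + pderivs js (\<lambda>x. \<Sum>i\<in>I. (\<beta> i \<circ> chart_inv c) x *\<^sub>R v i) x"
    by (rule pderivs_add[OF smooth_maps_chart[OF c f] smooth_on_perturb_sum(2)[OF c] open_chart_image[OF c] x])
  also have "pderivs js (\<lambda>x. \<Sum>i\<in>I. (\<beta> i \<circ> chart_inv c) x *\<^sub>R v i) x =
      (\<Sum>i\<in>I. pderivs js (\<lambda>x. (\<beta> i \<circ> chart_inv c) x *\<^sub>R v i) x)"
    by (rule pderivs_sum[OF smooth_on_perturb_sum(1)[OF c] open_chart_image[OF c] x])
  also have "\<dots> = (\<Sum>i\<in>I. pderivs js (\<beta> i \<circ> chart_inv c) x *\<^sub>R v i)"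
    by (intro sum.cong refl bounded_linear.pderivs_comp[OF bounded_linear_scaleR_left
          smooth_maps_chart[OF c \<beta>] open_chart_image[OF c] x])
  finally show ?thesis .
qed

text \<open>Along a fixed finite family of smooth functions \<open>\<beta> i\<close>, the derivatives of the perturbation are
  linear in the coefficients, with factors that are bounded on compact sets.\<close>

lemma limitin_perturb:
  assumes "\<And>i. i \<in> I \<Longrightarrow> ((\<lambda>s. v s i) \<longlongrightarrow> 0) F"
  shows "limitin (whitney_topology M A) (\<lambda>s. perturb f I \<beta> (v s)) f F"
proof (rule limitin_whitney[OF f perturb_smooth])
  fix c K js and \<epsilon> :: real
  assume c: "c \<in> A" and K: "compactin M K" "K \<subseteq> fst c" and "0 < \<epsilon>"
  have "\<exists>C. \<forall>p\<in>K. norm (pderivs js (\<beta> i \<circ> chart_inv c) (snd c p)) \<le> C" if "i \<in> I" for i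
  proof -
    have "continuous_on (snd c ` K) (pderivs js (\<beta> i \<circ> chart_inv c))"
      using K smooth_maps_chart[OF c \<beta>[OF that]]
      by (intro smooth_on_imp_continuous_on smooth_on_pderivs)
        (auto intro!: smooth_on_subset[where W = "snd c ` fst c"])
    then have "bounded (pderivs js (\<beta> i \<circ> chart_inv c) ` snd c ` K)"
      by (intro compact_imp_bounded compact_continuous_image compact_image_chart[OF c K])
    then show ?thesis by (auto simp: bounded_iff)
  qed
  then obtain C where C: "\<And>i p. i \<in> I \<Longrightarrow> p \<in> K \<Longrightarrow> norm (pderivs js (\<beta> i \<circ> chart_inv c) (snd c p)) \<le> C i"
    by metis
  have "((\<lambda>s. \<Sum>i\<in>I. C i * norm (v s i)) \<longlongrightarrow> (\<Sum>i\<in>I. C i * norm (0::'b))) F"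
    by (intro tendsto_intros assms)
  then have "eventually (\<lambda>s. (\<Sum>i\<in>I. C i * norm (v s i)) < \<epsilon>) F"
    using \<open>0 < \<epsilon>\<close> by (auto dest: order_tendstoD(2))
  then show "eventually (\<lambda>s. \<forall>p\<in>K. norm (pderivs js (perturb f I \<beta> (v s) \<circ> chart_inv c) (snd c p)
         - pderivs js (f \<circ> chart_inv c) (snd c p)) < \<epsilon>) F"
  proof (rule eventually_mono, intro ballI)
    fix s p assume s: "(\<Sum>i\<in>I. C i * norm (v s i)) < \<epsilon>" and p: "p \<in> K"
    have "norm (pderivs js (perturb f I \<beta> (v s) \<circ> chart_inv c) (snd c p) - pderivs js (f \<circ> chart_inv c) (snd c p))
      = norm (\<Sum>i\<in>I. pderivs js (\<beta> i \<circ> chart_inv c) (snd c p) *\<^sub>R v s i)"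
      using p K by (subst pderivs_perturb[OF c]) auto
    also have "\<dots> \<le> (\<Sum>i\<in>I. C i * norm (v s i))"
      by (intro sum_norm_le) (simp add: mult_right_mono C[OF _ p, unfolded real_norm_def])
    finally show "norm (pderivs js (perturb f I \<beta> (v s) \<circ> chart_inv c) (snd c p)
         - pderivs js (f \<circ> chart_inv c) (snd c p)) < \<epsilon>" using s by linarith
  qed
qed

end

definition extend_by_zero :: "'a chart \<Rightarrow> (real^2 \<Rightarrow> real) \<Rightarrow> 'a \<Rightarrow> real" where
  "extend_by_zero c \<rho> = (\<lambda>p\<in>topspace M. if p \<in> fst c then \<rho> (snd c p) else 0)"

text \<open>A chart domain \<open>d\<close> is the union of two open pieces: on the overlap with \<open>c\<close> the function is \<open>\<rho>\<close>
  composed with the transition map, and off the support it is zero. The support is closed in \<open>M\<close>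
  because compact sets in Hausdorff spaces are.\<close>

lemma extend_by_zero_smooth:
  assumes c: "c \<in> A" and C: "compact C" "C \<subseteq> snd c ` fst c"
    and \<rho>: "smooth_on UNIV \<rho>" "\<And>x. x \<notin> C \<Longrightarrow> \<rho> x = 0"
  shows "extend_by_zero c \<rho> \<in> smooth_maps M A"
proof -
  have "closedin M (chart_inv c ` C)"
    by (rule compactin_imp_closedin[OF Hausdorff compactin_chart_inv[OF c C]])
  then have V: "openin M (topspace M - chart_inv c ` C)"
    by auto
  have "smooth_on (snd d ` fst d) (extend_by_zero c \<rho> \<circ> chart_inv d)" if d: "d \<in> A" for d
  proof -
    have *: "fst d = (fst d \<inter> fst c) \<union> (fst d \<inter> (topspace M - chart_inv c ` C))"
      using C(2) chart_domain_subset[OF d] chart_inv_chart[OF c] by (auto dest!: subsetD[OF C(2)])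
    have "smooth_on (snd d ` (fst d \<inter> fst c)) (extend_by_zero c \<rho> \<circ> chart_inv d)"
      by (rule smooth_on_cong[OF open_overlap[OF d c], of "\<rho> \<circ> transition d c"])
        (use chart_domain_subset[OF d] chart_inv_chart[OF d] transition_chart[OF d c] in \<open>auto simp: extend_by_zero_def
          intro!: smooth_on_compose[OF open_overlap[OF d c] _ \<rho>(1) transition_smooth[OF d c]]\<close>)
    moreover have "smooth_on (snd d ` (fst d \<inter> (topspace M - chart_inv c ` C))) (extend_by_zero c \<rho> \<circ> chart_inv d)"
    proof (rule smooth_on_cong[OF open_image_chart[OF d V] _ smooth_on_const])
      fix x assume "x \<in> snd d ` (fst d \<inter> (topspace M - chart_inv c ` C))"
      then obtain p where p: "x = snd d p" "p \<in> fst d" "p \<in> topspace M" "p \<notin> chart_inv c ` C"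
        by auto
      have "snd c p \<notin> C" if "p \<in> fst c"
        using p(4) chart_inv_chart[OF c that] by (metis imageI)
      then show "0 = (extend_by_zero c \<rho> \<circ> chart_inv d) x"
        using p \<rho>(2) by (auto simp: extend_by_zero_def chart_inv_chart[OF d])
    qed
    ultimately show ?thesis
      by (subst *, subst image_Un) (rule smooth_on_Un)
  qed
  then show ?thesis
    by (auto simp: smooth_maps_def extend_by_zero_def)
qed

end

section \<open>Bivectors and open conditions on two-jets\<close>

lemma bounded_bilinear_wedge: "bounded_bilinear wedge"
  unfolding bilinear_conv_bounded_bilinear[symmetric] bilinear_def linear_iff
  by (auto simp: wedge_def vec_eq_iff algebra_simps)

interpretation wedge: bounded_bilinear wedge
  by (rule bounded_bilinear_wedge)

lemma wedge_mult_vec: "wedge v w *v z = (w \<bullet> z) *\<^sub>R v - (v \<bullet> z) *\<^sub>R w"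
  by (simp add: vec_eq_iff matrix_vector_mult_def wedge_def inner_vec_def sum_4 algebra_simps)

lemma wedge_self: "wedge v v = 0"
  by (simp add: wedge_def vec_eq_iff)

lemma wedge_commute: "wedge w v = - wedge v w"
  by (simp add: wedge_def vec_eq_iff)

lemma inner_wedge: "wedge v w \<bullet> wedge v' w' = 2 * ((v \<bullet> v') * (w \<bullet> w') - (v \<bullet> w') * (w \<bullet> v'))"
  by (simp add: wedge_def inner_vec_def sum_4 algebra_simps)

lemma norm_wedge_orthonormal2:
  assumes "orthonormal2 v w"
  shows "norm (wedge v w) = sqrt 2"
proof -
  have "v \<bullet> v = 1" "w \<bullet> w = 1" "v \<bullet> w = 0"
    using assms by (auto simp: orthonormal2_def norm_eq_1)
  then have "wedge v w \<bullet> wedge v w = 2"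
    by (simp add: inner_wedge)
  then show ?thesis
    by (simp add: norm_eq_sqrt_inner)
qed

lemma linear_real2:
  fixes D :: "real^2 \<Rightarrow> 'b::real_vector"
  assumes "linear D"
  shows "D a = (a $ 1) *\<^sub>R D (axis 1 1) + (a $ 2) *\<^sub>R D (axis 2 1)"
proof -
  have "a = (a $ 1) *\<^sub>R axis 1 1 + (a $ 2) *\<^sub>R axis 2 1"
    by (simp add: vec_eq_iff forall_2 axis_def)
  then show ?thesis
    using linear_add[OF assms] linear_scale[OF assms] by metis
qed

lemma wedge_linear:
  assumes "linear D"
  shows "wedge (D a) (D b) = det (vector [a, b] :: real^2^2) *\<^sub>R wedge (D (axis 1 1)) (D (axis 2 1))"
  unfolding linear_real2[OF assms, of a] linear_real2[OF assms, of b]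
  by (simp add: wedge.add_left wedge.add_right wedge.scaleR_left wedge.scaleR_right wedge_self
      wedge_commute[of "D (axis 2 1)" "D (axis 1 1)"] det_2 algebra_simps)

lemma inj_linear_iff_wedge:
  fixes D :: "real^2 \<Rightarrow> real^4"
  assumes "linear D"
  shows "inj D \<longleftrightarrow> wedge (D (axis 1 1)) (D (axis 2 1)) \<noteq> 0"
proof
  assume inj: "inj D"
  define u1 u2 where "u1 = D (axis 1 1)" and "u2 = D (axis 2 1)"
  show "wedge (D (axis 1 1)) (D (axis 2 1)) \<noteq> 0"
  proof
    assume "wedge (D (axis 1 1)) (D (axis 2 1)) = 0"
    then have "(u2 \<bullet> u2) *\<^sub>R u1 - (u1 \<bullet> u2) *\<^sub>R u2 = 0"
      using wedge_mult_vec[of u1 u2 u2] by (simp add: u1_def u2_def)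
    then have "D (vector [u2 \<bullet> u2, - (u1 \<bullet> u2)]) = 0"
      by (subst linear_real2[OF assms]) (simp add: u1_def u2_def)
    then have "(vector [u2 \<bullet> u2, - (u1 \<bullet> u2)] :: real^2) = 0"
      using inj linear_injective_0[OF assms] by blast
    then have "u2 = 0"
      by (simp add: vec_eq_iff forall_2)
    then have "axis 2 1 = (0 :: real^2)"
      using inj linear_injective_0[OF assms] u2_def by metis
    then show False by (simp add: axis_eq_0_iff)
  qed
next
  assume nz: "wedge (D (axis 1 1)) (D (axis 2 1)) \<noteq> 0"
  have "a = 0" if "D a = 0" for a
  proof -
    have "det (vector [a, b] :: real^2^2) = 0" for b
      using wedge_linear[OF assms, of a b] nz that by (simp add: wedge.zero_left)
    from this[of "axis 1 1"] this[of "axis 2 1"] show ?thesis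
      by (simp add: det_2 axis_def vec_eq_iff forall_2)
  qed
  then show "inj D"
    using linear_injective_0[OF assms] by blast
qed

text \<open>The relation says that moving \<open>u1\<close> and \<open>u2\<close> with velocities \<open>w1\<close> and \<open>w2\<close> changes \<open>wedge u1 u2\<close> only in
  length. Then the velocities are tangent to the plane: contracting the relation with the dual
  vectors \<open>z1\<close> and \<open>z2\<close> of \<open>u1\<close> and \<open>u2\<close> in that plane isolates \<open>w2\<close> and \<open>w1\<close>.\<close>

lemma wedge_relation_in_span:
  assumes nz: "wedge u1 u2 \<noteq> 0" and eq: "wedge w1 u2 + wedge u1 w2 = c *\<^sub>R wedge u1 u2"
  shows "\<exists>a b a' b'. w1 = a *\<^sub>R u1 + b *\<^sub>R u2 \<and> w2 = a' *\<^sub>R u1 + b' *\<^sub>R u2"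
proof -
  define g where "g = (u1 \<bullet> u1) * (u2 \<bullet> u2) - (u1 \<bullet> u2) * (u1 \<bullet> u2)"
  have gram: "g \<noteq> 0"
    using nz inner_wedge[of u1 u2 u1 u2] by (auto simp: g_def inner_commute)
  have *: "(u2 \<bullet> z) *\<^sub>R w1 - (w1 \<bullet> z) *\<^sub>R u2 + ((w2 \<bullet> z) *\<^sub>R u1 - (u1 \<bullet> z) *\<^sub>R w2)
      = c *\<^sub>R ((u2 \<bullet> z) *\<^sub>R u1 - (u1 \<bullet> z) *\<^sub>R u2)" for z
    using arg_cong[OF eq, of "\<lambda>m. m *v z"]
    by (simp add: matrix_vector_mult_add_rdistrib scaleR_matrix_vector_assoc[symmetric] wedge_mult_vec)
  \<comment> \<open>Vectors of the plane orthogonal to \<open>u2\<close> and \<open>u1\<close>; \<open>g\<close> is the Gram determinant.\<close>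
  define y1 y2 where "y1 = (u2 \<bullet> u2) *\<^sub>R u1 - (u1 \<bullet> u2) *\<^sub>R u2"
    and "y2 = (u1 \<bullet> u1) *\<^sub>R u2 - (u1 \<bullet> u2) *\<^sub>R u1"
  have y: "u1 \<bullet> y1 = g" "u2 \<bullet> y1 = 0" "u1 \<bullet> y2 = 0" "u2 \<bullet> y2 = g"
    by (auto simp: y1_def y2_def g_def inner_diff_right inner_commute)
  define z1 z2 where "z1 = inverse g *\<^sub>R y1" and "z2 = inverse g *\<^sub>R y2"
  have z: "u1 \<bullet> z1 = 1" "u2 \<bullet> z1 = 0" "u1 \<bullet> z2 = 0" "u2 \<bullet> z2 = 1"
    using gram by (auto simp: z1_def z2_def y)
  have "w1 = (c - w2 \<bullet> z2) *\<^sub>R u1 + (w1 \<bullet> z2) *\<^sub>R u2"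
    using *[of z2] by (simp add: z algebra_simps)
  moreover have "w2 = (w2 \<bullet> z1) *\<^sub>R u1 + (c - w1 \<bullet> z1) *\<^sub>R u2"
    using *[of z1] by (simp add: z algebra_simps)
  ultimately show ?thesis by blast
qed

text \<open>This is the tube lemma.\<close>

lemma open_forall_compact:
  fixes g :: "'q::topological_space \<Rightarrow> 's::topological_space \<Rightarrow> 'v::t1_space"
  assumes "compact S" "continuous_on UNIV (\<lambda>x. g (fst x) (snd x))"
  shows "open {q. \<forall>s\<in>S. g q s \<noteq> v}"
proof (subst open_subopen, intro ballI)
  have W: "open {x. g (fst x) (snd x) \<noteq> v}"
    using open_vimage[OF open_Compl[OF closed_singleton, of v] assms(2)] by (simp add: vimage_def)
  fix q assume "q \<in> {q. \<forall>s\<in>S. g q s \<noteq> v}"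
  then have "{q} \<times> S \<subseteq> {x. g (fst x) (snd x) \<noteq> v}" by auto
  from Elementary_Topology.tube_lemma[OF assms(1) W this] obtain X0 where X0: "q \<in> X0" "open X0" "X0 \<times> S \<subseteq> {x. g (fst x) (snd x) \<noteq> v}"
    by auto
  then have "X0 \<subseteq> {q. \<forall>s\<in>S. g q s \<noteq> v}"
    by (auto simp: subset_iff)
  then show "\<exists>T. open T \<and> q \<in> T \<and> T \<subseteq> {q. \<forall>s\<in>S. g q s \<noteq> v}" using X0 by auto
qed

definition independent3 :: "'v::real_vector \<Rightarrow> 'v \<Rightarrow> 'v \<Rightarrow> bool" where
  "independent3 x y z \<longleftrightarrow> (\<forall>a b c. a *\<^sub>R x + b *\<^sub>R y + c *\<^sub>R z = 0 \<longrightarrow> a = 0 \<and> b = 0 \<and> c = 0)"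

lemma independent3_iff_sphere:
  "independent3 x y z \<longleftrightarrow> (\<forall>s\<in>sphere (0 :: real \<times> real \<times> real) 1.
     fst s *\<^sub>R x + fst (snd s) *\<^sub>R y + snd (snd s) *\<^sub>R z \<noteq> 0)" (is "?L \<longleftrightarrow> ?R")
proof
  assume L: ?L
  show ?R
  proof (intro ballI notI)
    fix s :: "real \<times> real \<times> real"
    assume s: "s \<in> sphere 0 1" and "fst s *\<^sub>R x + fst (snd s) *\<^sub>R y + snd (snd s) *\<^sub>R z = 0"
    then have "s = 0"
      using L unfolding independent3_def by (auto simp: prod_eq_iff)
    with s show False by simp
  qed
next
  assume R: ?R
  show ?L
    unfolding independent3_def
  proof (intro allI impI)
    fix a b c assume 0: "a *\<^sub>R x + b *\<^sub>R y + c *\<^sub>R z = 0"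
    show "a = 0 \<and> b = 0 \<and> c = 0"
    proof (rule ccontr)
      assume "\<not> (a = 0 \<and> b = 0 \<and> c = 0)"
      then have "(a, b, c) \<noteq> 0" by (auto simp: zero_prod_def)
      then have "inverse (norm (a, b, c)) *\<^sub>R (a, b, c) \<in> sphere 0 1"
        by (simp del: scaleR_Pair)
      moreover have "inverse (norm (a, b, c)) *\<^sub>R (a *\<^sub>R x + b *\<^sub>R y + c *\<^sub>R z) = 0"
        unfolding 0 by simp
      ultimately show False
        using R[rule_format, of "inverse (norm (a, b, c)) *\<^sub>R (a, b, c)"]
        by (simp add: scaleR_right_distrib)
    qed
  qed
qed

text \<open>By homogeneity it suffices to exclude relations with coefficients on the unit sphere, which is compact.\<close>

lemma open_independent3:
  assumes "continuous_on UNIV f" "continuous_on UNIV g" "continuous_on UNIV h"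
  shows "open {q :: 'q::topological_space. independent3 (f q) (g q) (h q :: 'v::real_normed_vector)}"
  unfolding independent3_iff_sphere
proof (rule open_forall_compact[OF compact_sphere])
  have *: "continuous_on UNIV (\<lambda>x. k (fst x))" if "continuous_on UNIV k"
    for k :: "'q \<Rightarrow> 'v"
    by (rule continuous_on_compose2[OF that]) (auto intro!: continuous_intros)
  show "continuous_on UNIV (\<lambda>x. fst (snd x) *\<^sub>R f (fst x) + fst (snd (snd x)) *\<^sub>R g (fst x) +
     snd (snd (snd x)) *\<^sub>R h (fst x))"
    by (intro continuous_intros * assms)
qed

type_synonym two_jet =
  "(real^4) \<times> (real^4) \<times> (real^4) \<times> (real^4) \<times> (real^4) \<times> (real^4)"

definition immersive_jets :: "two_jet set" where
  "immersive_jets = {(u1, u2, h11, h12, h21, h22). wedge u1 u2 \<noteq> 0}"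

text \<open>For the jet of \<open>f\<close>, the three bivectors are the two partial derivatives of \<open>\<partial>\<^sub>1 f \<and> \<partial>\<^sub>2 f\<close> and this bivector
  itself. Their independence means that \<open>\<partial>\<^sub>1 f \<and> \<partial>\<^sub>2 f\<close> is nonzero and that its derivative along a
  nonzero tangent direction is never a multiple of it; the Gauss map is \<open>\<partial>\<^sub>1 f \<and> \<partial>\<^sub>2 f\<close> up to normalisation.\<close>

definition gauss_regular_jets :: "two_jet set" where
  "gauss_regular_jets = {(u1, u2, h11, h12, h21, h22).
     independent3 (wedge h11 u2 + wedge u1 h12) (wedge h21 u2 + wedge u1 h22) (wedge u1 u2)}"

lemma open_immersive_jets: "open immersive_jets"
proof -
  have eq: "immersive_jets = (\<lambda>J. wedge (fst J) (fst (snd J))) -` (- {0})"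
    by (auto simp: immersive_jets_def)
  show ?thesis
    unfolding eq by (intro open_vimage wedge.continuous_on continuous_intros open_Compl closed_singleton)
qed

lemma open_gauss_regular_jets: "open gauss_regular_jets"
proof -
  have eq: "gauss_regular_jets = {J. independent3
     (wedge (fst (snd (snd J))) (fst (snd J)) + wedge (fst J) (fst (snd (snd (snd J)))))
     (wedge (fst (snd (snd (snd (snd J))))) (fst (snd J)) + wedge (fst J) (snd (snd (snd (snd (snd J))))))
     (wedge (fst J) (fst (snd J)))}"
    by (auto simp: gauss_regular_jets_def)
  show ?thesis
    unfolding eq by (intro open_independent3 wedge.continuous_on continuous_intros)
qed

text \<open>The derivative of the normalised field is \<open>\<lambda> d\<Omega> + d\<lambda> \<Omega>\<close>, where \<open>\<lambda> = k / |\<Omega>|\<close>. It is orthogonal to \<open>\<Omega>\<close>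
  because the norm is constant, so it vanishes in exactly those directions in which \<open>d\<Omega>\<close> is a multiple
  of \<open>\<Omega>\<close>.\<close>

lemma inj_derivative_normalized_iff:
  fixes \<Omega> :: "'a::real_normed_vector \<Rightarrow> 'b::real_inner"
  assumes W: "open W" "x \<in> W" and nz: "\<And>y. y \<in> W \<Longrightarrow> \<Omega> y \<noteq> 0"
    and diff: "\<Omega> differentiable (at x)" and k: "k > 0"
  shows "inj (frechet_derivative (\<lambda>y. (k / norm (\<Omega> y)) *\<^sub>R \<Omega> y) (at x)) \<longleftrightarrow>
    (\<forall>X c. frechet_derivative \<Omega> (at x) X = c *\<^sub>R \<Omega> x \<longrightarrow> X = 0)"
proof -
  define l where "l y = k / norm (\<Omega> y)" for y
  have l: "l x > 0" using k nz[OF W(2)] by (simp add: l_def)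
  define G where "G y = l y *\<^sub>R \<Omega> y" for y
  define d where "d = frechet_derivative \<Omega> (at x)"
  have d: "(\<Omega> has_derivative d) (at x)"
    using diff by (simp add: d_def frechet_derivative_works)
  have "(\<lambda>y. norm (\<Omega> y)) differentiable (at x)"
    using differentiable_compose[OF differentiable_norm_at diff] nz[OF W(2)] by (simp add: o_def)
  then have "l differentiable (at x)"
    unfolding l_def using nz[OF W(2)] by (intro differentiable_divide differentiable_const) auto
  then obtain l' where l': "(l has_derivative l') (at x)"
    by (auto simp: differentiable_def)
  have G': "(G has_derivative (\<lambda>X. l x *\<^sub>R d X + l' X *\<^sub>R \<Omega> x)) (at x)"
    unfolding G_def by (rule has_derivative_scaleR[OF l' d])
  have dG: "frechet_derivative G (at x) = (\<lambda>X. l x *\<^sub>R d X + l' X *\<^sub>R \<Omega> x)"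
    using frechet_derivative_at[OF G'] by simp
  have lin: "linear (frechet_derivative G (at x))"
    using G' by (intro linear_frechet_derivative) (auto simp: differentiable_def)
  have orth: "(l x *\<^sub>R d X + l' X *\<^sub>R \<Omega> x) \<bullet> \<Omega> x = 0" for X
  proof -
    have "((\<lambda>y. G y \<bullet> G y) has_derivative (\<lambda>X. G x \<bullet> (l x *\<^sub>R d X + l' X *\<^sub>R \<Omega> x) + (l x *\<^sub>R d X + l' X *\<^sub>R \<Omega> x) \<bullet> G x)) (at x)"
      by (rule has_derivative_inner[OF G' G'])
    moreover have "((\<lambda>y. G y \<bullet> G y) has_derivative (\<lambda>X. 0)) (at x)"
    proof (subst has_derivative_cong_open[OF W(1) _ W(2), of _ "\<lambda>y. k * k"])
      show "G y \<bullet> G y = k * k" if "y \<in> W" for y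
        using nz[OF that] by (simp add: G_def l_def dot_square_norm power2_eq_square)
    qed simp
    ultimately have "(\<lambda>X. G x \<bullet> (l x *\<^sub>R d X + l' X *\<^sub>R \<Omega> x) + (l x *\<^sub>R d X + l' X *\<^sub>R \<Omega> x) \<bullet> G x) = (\<lambda>X. 0)"
      by (rule has_derivative_unique)
    then have "G x \<bullet> (l x *\<^sub>R d X + l' X *\<^sub>R \<Omega> x) + (l x *\<^sub>R d X + l' X *\<^sub>R \<Omega> x) \<bullet> G x = 0"
      by (rule fun_cong)
    then have "G x \<bullet> (l x *\<^sub>R d X + l' X *\<^sub>R \<Omega> x) = 0"
      by (simp add: inner_commute)
    then show ?thesis
      using l by (simp add: G_def inner_commute)
  qed
  have "inj (frechet_derivative G (at x)) \<longleftrightarrow> (\<forall>X. l x *\<^sub>R d X + l' X *\<^sub>R \<Omega> x = 0 \<longrightarrow> X = 0)"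
    using linear_injective_0[OF lin] by (simp only: dG)
  also have "\<dots> \<longleftrightarrow> (\<forall>X c. d X = c *\<^sub>R \<Omega> x \<longrightarrow> X = 0)"
  proof (intro iffI allI impI)
    fix X c
    assume inj: "\<forall>X. l x *\<^sub>R d X + l' X *\<^sub>R \<Omega> x = 0 \<longrightarrow> X = 0" and c: "d X = c *\<^sub>R \<Omega> x"
    have "(l x * c + l' X) * (\<Omega> x \<bullet> \<Omega> x) = 0"
      using orth[of X] by (simp add: c inner_add_left algebra_simps)
    then have "l x * c + l' X = 0"
      using nz[OF W(2)] by simp
    then have "l x *\<^sub>R d X + l' X *\<^sub>R \<Omega> x = 0"
      by (metis c scaleR_left_distrib scaleR_scaleR scaleR_zero_left)
    with inj show "X = 0" by blast
  next
    fix X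
    assume reg: "\<forall>X c. d X = c *\<^sub>R \<Omega> x \<longrightarrow> X = 0" and 0: "l x *\<^sub>R d X + l' X *\<^sub>R \<Omega> x = 0"
    have "d X = (1 / l x) *\<^sub>R (l x *\<^sub>R d X)"
      using l by simp
    also have "l x *\<^sub>R d X = - l' X *\<^sub>R \<Omega> x"
      using 0 by (simp add: eq_neg_iff_add_eq_0)
    finally have "d X = (1 / l x * - l' X) *\<^sub>R \<Omega> x" by simp
    with reg show "X = 0" by blast
  qed
  finally show ?thesis
    by (simp add: G_def[abs_def] l_def d_def)
qed

section \<open>The Gauss map in charts\<close>

lemma det_linear_image:
  fixes T :: "real^2 \<Rightarrow> real^2"
  assumes "linear T"
  shows "det (vector [T a, T b] :: real^2^2) = det (vector [a, b] :: real^2^2) * det (matrix T)"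
  unfolding linear_real2[OF assms, of a] linear_real2[OF assms, of b]
  by (simp add: det_2 matrix_def algebra_simps)

text \<open>Gram-Schmidt; the matrix of the change of basis is triangular with positive diagonal.\<close>

lemma positive_orthonormal_combination:
  assumes nz: "wedge u1 u2 \<noteq> 0"
  shows "\<exists>a b :: real^2. 0 < det (vector [a, b] :: real^2^2) \<and>
    orthonormal2 ((a $ 1) *\<^sub>R u1 + (a $ 2) *\<^sub>R u2) ((b $ 1) *\<^sub>R u1 + (b $ 2) *\<^sub>R u2)"
proof -
  define y where "y = u2 - ((u1 \<bullet> u2) / (u1 \<bullet> u1)) *\<^sub>R u1"
  have u1: "u1 \<noteq> 0" using nz by (auto simp: wedge.zero_left)
  have "wedge u1 y = wedge u1 u2"
    by (simp add: y_def wedge.diff_right wedge.scaleR_right wedge_self)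
  then have y: "y \<noteq> 0" using nz by (auto simp: wedge.zero_right)
  have orth: "u1 \<bullet> y = 0"
    using u1 by (simp add: y_def inner_diff_right)
  define a b :: "real^2" where "a = vector [1 / norm u1, 0]"
    and "b = vector [- ((u1 \<bullet> u2) / (u1 \<bullet> u1)) / norm y, 1 / norm y]"
  have "(a $ 1) *\<^sub>R u1 + (a $ 2) *\<^sub>R u2 = (1 / norm u1) *\<^sub>R u1"
    by (simp add: a_def)
  moreover have "(b $ 1) *\<^sub>R u1 + (b $ 2) *\<^sub>R u2 = (1 / norm y) *\<^sub>R y"
    by (simp add: b_def y_def scaleR_diff_right)
  moreover have "orthonormal2 ((1 / norm u1) *\<^sub>R u1) ((1 / norm y) *\<^sub>R y)"
    using u1 y orth by (simp add: orthonormal2_def)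
  moreover have "0 < det (vector [a, b] :: real^2^2)"
    using u1 y by (simp add: det_2 a_def b_def)
  ultimately show ?thesis by metis
qed

lemma chart_deriv_axis: "chart_deriv c f p (axis i 1) = pderivs [i] (f \<circ> chart_inv c) (snd c p)"
  by (simp add: chart_deriv_def)

definition tangent_bivector :: "(real^2 \<Rightarrow> real^4) \<Rightarrow> real^2 \<Rightarrow> real^4^4" where
  "tangent_bivector F x = wedge (pderivs [1] F x) (pderivs [2] F x)"

lemma smooth_on_tangent_bivector:
  "open W \<Longrightarrow> smooth_on W F \<Longrightarrow> smooth_on W (tangent_bivector F)"
  unfolding tangent_bivector_def[abs_def]
  by (intro wedge.smooth_on_prod smooth_on_pderivs)

lemma partial_tangent_bivector:
  assumes "smooth_on W F" "x \<in> W"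
  shows "partial i (tangent_bivector F) x =
    wedge (pderivs [i, 1] F x) (pderivs [2] F x) + wedge (pderivs [1] F x) (pderivs [i, 2] F x)"
proof -
  have "(pderivs [j] F has_derivative frechet_derivative (pderivs [j] F) (at x)) (at x)" for j
    using assms smooth_on_def by (metis frechet_derivative_works)
  from has_derivative_partial[OF wedge.FDERIV[OF this[of 1] this[of 2]], of i]
  show ?thesis
    by (simp add: tangent_bivector_def[abs_def] add.commute)
qed

lemma jet2_immersive_iff: "jet2 F x \<in> immersive_jets \<longleftrightarrow> tangent_bivector F x \<noteq> 0"
  by (simp add: jet2_def immersive_jets_def tangent_bivector_def)

lemma jet2_gauss_regular_iff:
  assumes "smooth_on W F" "x \<in> W"
  shows "jet2 F x \<in> gauss_regular_jets \<longleftrightarrow> independent3 (partial 1 (tangent_bivector F) x)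
    (partial 2 (tangent_bivector F) x) (tangent_bivector F x)"
  unfolding partial_tangent_bivector[OF assms]
  by (simp add: jet2_def gauss_regular_jets_def tangent_bivector_def)

context surface
begin

lemma linear_chart_deriv:
  assumes "f \<in> smooth_maps M A" "c \<in> A" "p \<in> fst c"
  shows "linear (chart_deriv c f p)"
  unfolding chart_deriv_def using assms
  by (intro linear_frechet_derivative smooth_on_imp_differentiable[OF smooth_maps_chart]) auto

lemma inj_chart_deriv_iff:
  assumes "f \<in> smooth_maps M A" "c \<in> A" "p \<in> fst c"
  shows "inj (chart_deriv c f p) \<longleftrightarrow> jet2 (f \<circ> chart_inv c) (snd c p) \<in> immersive_jets"
  unfolding inj_linear_iff_wedge[OF linear_chart_deriv[OF assms]] jet2_immersive_iff tangent_bivector_def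
    chart_deriv_axis ..

text \<open>Another oriented chart and another positive basis multiply the bivector by positive determinants
  only, and the norm of \<open>wedge v w\<close> is \<open>sqrt 2\<close> for every orthonormal pair. Hence all positive
  orthonormal bases give the same bivector, and the description in \<open>gauss_map\<close> is unique.\<close>

lemma gauss_map_chart_wedge:
  assumes f: "f \<in> immersions M A UNIV" and c: "c \<in> A" and p: "p \<in> fst c"
  defines "\<omega> \<equiv> tangent_bivector (f \<circ> chart_inv c) (snd c p)"
  shows "\<exists>v w. tangent_onb A f p v w"
    and "tangent_onb A f p v w \<Longrightarrow> wedge v w = (sqrt 2 / norm \<omega>) *\<^sub>R \<omega>"
proof -
  have fs: "f \<in> smooth_maps M A" using f by (simp add: immersions_def)
  note lin = linear_chart_deriv[OF fs c p]
  have \<omega>: "wedge (chart_deriv c f p (axis 1 1)) (chart_deriv c f p (axis 2 1)) = \<omega>"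
    by (simp only: \<omega>_def tangent_bivector_def chart_deriv_axis)
  have nz: "\<omega> \<noteq> 0"
    using f c p inj_linear_iff_wedge[OF lin] by (auto simp: \<omega> immersions_def)
  obtain a b :: "real^2" where ab: "0 < det (vector [a, b] :: real^2^2)"
    "orthonormal2 (chart_deriv c f p a) (chart_deriv c f p b)"
    using positive_orthonormal_combination[of "chart_deriv c f p (axis 1 1)" "chart_deriv c f p (axis 2 1)"] nz
    unfolding \<omega> linear_real2[OF lin, symmetric] by blast
  then show "\<exists>v w. tangent_onb A f p v w"
    unfolding tangent_onb_def using c p by blast
  assume onb: "tangent_onb A f p v w"
  then obtain d a b where d: "d \<in> A" "p \<in> fst d" and ab: "0 < det (vector [a, b] :: real^2^2)"
      "v = chart_deriv d f p a" "w = chart_deriv d f p b" and on: "orthonormal2 v w"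
    unfolding tangent_onb_def by blast
  define T where "T = frechet_derivative (transition d c) (at (snd d p))"
  have pin: "snd d p \<in> snd d ` (fst d \<inter> fst c)" using p d by auto
  have T: "linear T" "0 < det (matrix T)"
    using transition_deriv_bij(1)[OF d(1) c pin] transition_det[OF d(1) c pin] by (auto simp: T_def)
  have "wedge v w = wedge (chart_deriv c f p (T a)) (chart_deriv c f p (T b))"
    unfolding ab(2,3) chart_deriv_transition[OF d(1) c fs d(2) p] T_def by simp
  also have "\<dots> = (det (vector [a, b] :: real^2^2) * det (matrix T)) *\<^sub>R \<omega>"
    unfolding wedge_linear[OF lin, of "T a"] det_linear_image[OF T(1)] \<omega> ..
  finally obtain k where k: "k > 0" "wedge v w = k *\<^sub>R \<omega>"
    using ab(1) T(2) by (meson mult_pos_pos)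
  then have "sqrt 2 = k * norm \<omega>"
    using norm_wedge_orthonormal2[OF on] by simp
  with k nz show "wedge v w = (sqrt 2 / norm \<omega>) *\<^sub>R \<omega>"
    by simp
qed

lemma gauss_map_eq:
  assumes f: "f \<in> immersions M A UNIV" and c: "c \<in> A" and p: "p \<in> fst c"
  defines "\<omega> \<equiv> tangent_bivector (f \<circ> chart_inv c) (snd c p)"
  shows "gauss_map M A f p = (sqrt 2 / norm \<omega>) *\<^sub>R \<omega>" and "gauss_map M A f p \<in> oriented_Gr"
proof -
  obtain v w where onb: "tangent_onb A f p v w"
    using gauss_map_chart_wedge(1)[OF f c p] by blast
  have *: "gauss_map M A f p = (THE \<omega>. \<exists>v w. tangent_onb A f p v w \<and> \<omega> = wedge v w)"
    using p chart_domain_subset[OF c] by (auto simp: gauss_map_def)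
  show **: "gauss_map M A f p = (sqrt 2 / norm \<omega>) *\<^sub>R \<omega>"
    unfolding *
  proof (rule the_equality)
    show "\<exists>v w. tangent_onb A f p v w \<and> (sqrt 2 / norm \<omega>) *\<^sub>R \<omega> = wedge v w"
      using onb gauss_map_chart_wedge(2)[OF f c p onb] unfolding \<omega>_def by metis
  next
    fix \<eta> assume "\<exists>v w. tangent_onb A f p v w \<and> \<eta> = wedge v w"
    then show "\<eta> = (sqrt 2 / norm \<omega>) *\<^sub>R \<omega>"
      using gauss_map_chart_wedge(2)[OF f c p] unfolding \<omega>_def by metis
  qed
  show "gauss_map M A f p \<in> oriented_Gr"
    unfolding ** \<omega>_def gauss_map_chart_wedge(2)[OF f c p onb, symmetric] oriented_Gr_def
    using onb by (auto simp: tangent_onb_def)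
qed

lemma gauss_map_chart:
  assumes f: "f \<in> immersions M A UNIV" and c: "c \<in> A" and x: "x \<in> snd c ` fst c"
  defines "\<Omega> \<equiv> tangent_bivector (f \<circ> chart_inv c)"
  shows "(gauss_map M A f \<circ> chart_inv c) x = (sqrt 2 / norm (\<Omega> x)) *\<^sub>R \<Omega> x" and "\<Omega> x \<noteq> 0"
proof -
  obtain p where p: "p \<in> fst c" "x = snd c p" using x by blast
  show "(gauss_map M A f \<circ> chart_inv c) x = (sqrt 2 / norm (\<Omega> x)) *\<^sub>R \<Omega> x"
    using gauss_map_eq(1)[OF f c p(1)] by (simp only: p(2) o_apply chart_inv_chart[OF c p(1)] \<Omega>_def)
  show "\<Omega> x \<noteq> 0"
    using f c p inj_chart_deriv_iff[of f c p] unfolding \<Omega>_def jet2_immersive_iff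
    by (auto simp: immersions_def)
qed

text \<open>In a chart the Gauss map is a smooth, nowhere vanishing bivector field divided by its norm, that is,
  multiplied by a power of its inner square.\<close>

lemma gauss_map_smooth:
  assumes f: "f \<in> immersions M A UNIV"
  shows "gauss_map M A f \<in> smooth_maps M A"
proof -
  have "smooth_on (snd c ` fst c) (gauss_map M A f \<circ> chart_inv c)" if c: "c \<in> A" for c
  proof -
    let ?W = "snd c ` fst c"
    define \<Omega> where "\<Omega> = tangent_bivector (f \<circ> chart_inv c)"
    have W: "open ?W" by (rule open_chart_image[OF c])
    have \<Omega>: "smooth_on ?W \<Omega>"
      unfolding \<Omega>_def using f c
      by (intro smooth_on_tangent_bivector W smooth_maps_chart) (auto simp: immersions_def)
    have "smooth_on ?W (\<lambda>x. (\<Omega> x \<bullet> \<Omega> x) powr (- 1 / 2))"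
      using bounded_bilinear.smooth_on_prod[OF bounded_bilinear_inner W \<Omega> \<Omega>]
        gauss_map_chart(2)[OF f c] unfolding smooth_on_iff_diff_order
      by (intro allI diff_order_powr W) (auto simp: \<Omega>_def)
    then have "smooth_on ?W (\<lambda>x. (sqrt 2 * (\<Omega> x \<bullet> \<Omega> x) powr (- 1 / 2)) *\<^sub>R \<Omega> x)"
      by (intro bounded_bilinear.smooth_on_prod[OF bounded_bilinear_scaleR]
          bounded_bilinear.smooth_on_prod[OF bounded_bilinear_mult] W \<Omega> smooth_on_const)
    then show ?thesis
    proof (rule smooth_on_cong[OF W, rotated])
      fix x assume x: "x \<in> ?W"
      have "(\<Omega> x \<bullet> \<Omega> x) powr (- 1 / 2) = 1 / norm (\<Omega> x)"
        using powr_minus[of "\<Omega> x \<bullet> \<Omega> x" "1 / 2"]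
        by (simp add: powr_half_sqrt norm_eq_sqrt_inner inverse_eq_divide)
      then show "(sqrt 2 * (\<Omega> x \<bullet> \<Omega> x) powr (- 1 / 2)) *\<^sub>R \<Omega> x = (gauss_map M A f \<circ> chart_inv c) x"
        using gauss_map_chart(1)[OF f c x] by (simp add: \<Omega>_def)
    qed
  qed
  then show ?thesis
    by (auto simp: smooth_maps_def gauss_map_def)
qed

lemma inj_gauss_deriv_iff:
  assumes f: "f \<in> immersions M A UNIV" and c: "c \<in> A" and p: "p \<in> fst c"
  shows "inj (chart_deriv c (gauss_map M A f) p) \<longleftrightarrow>
    jet2 (f \<circ> chart_inv c) (snd c p) \<in> gauss_regular_jets"
proof -
  let ?W = "snd c ` fst c"
  define \<Omega> x where "\<Omega> = tangent_bivector (f \<circ> chart_inv c)" and "x = snd c p"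
  have W: "open ?W" by (rule open_chart_image[OF c])
  have x: "x \<in> ?W" using p by (simp add: x_def)
  have F: "smooth_on ?W (f \<circ> chart_inv c)"
    using f c by (intro smooth_maps_chart) (auto simp: immersions_def)
  have diff: "\<Omega> differentiable (at x)"
    unfolding \<Omega>_def by (rule smooth_on_imp_differentiable[OF smooth_on_tangent_bivector[OF W F] x])
  have nz: "\<And>y. y \<in> ?W \<Longrightarrow> \<Omega> y \<noteq> 0"
    using gauss_map_chart(2)[OF f c] by (simp add: \<Omega>_def)
  have "chart_deriv c (gauss_map M A f) p =
      frechet_derivative (\<lambda>y. (sqrt 2 / norm (\<Omega> y)) *\<^sub>R \<Omega> y) (at x)"
    unfolding chart_deriv_def x_def[symmetric] \<Omega>_def
    by (rule frechet_derivative_cong_open[OF W gauss_map_chart(1)[OF f c] x])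
  then have "inj (chart_deriv c (gauss_map M A f) p) \<longleftrightarrow>
     (\<forall>X k. frechet_derivative \<Omega> (at x) X = k *\<^sub>R \<Omega> x \<longrightarrow> X = 0)"
    using inj_derivative_normalized_iff[OF W x nz diff] by simp
  also have "\<dots> \<longleftrightarrow> independent3 (partial 1 \<Omega> x) (partial 2 \<Omega> x) (\<Omega> x)"
  proof (intro iffI allI impI)
    assume *: "\<forall>X k. frechet_derivative \<Omega> (at x) X = k *\<^sub>R \<Omega> x \<longrightarrow> X = 0"
    show "independent3 (partial 1 \<Omega> x) (partial 2 \<Omega> x) (\<Omega> x)"
      unfolding independent3_def
    proof (intro allI impI)
      fix a b k assume 0: "a *\<^sub>R partial 1 \<Omega> x + b *\<^sub>R partial 2 \<Omega> x + k *\<^sub>R \<Omega> x = 0"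
      then have "frechet_derivative \<Omega> (at x) (vector [a, b]) = (- k) *\<^sub>R \<Omega> x"
        unfolding frechet_derivative_eq_sum_partial[OF diff] by (simp add: sum_2 eq_neg_iff_add_eq_0)
      with * have "(vector [a, b] :: real^2) = 0" by blast
      then have "a = 0 \<and> b = 0" by (simp add: vec_eq_iff forall_2)
      with 0 nz[OF x] show "a = 0 \<and> b = 0 \<and> k = 0" by simp
    qed
  next
    fix X k
    assume "independent3 (partial 1 \<Omega> x) (partial 2 \<Omega> x) (\<Omega> x)"
      and "frechet_derivative \<Omega> (at x) X = k *\<^sub>R \<Omega> x"
    moreover from this(2) have "(X $ 1) *\<^sub>R partial 1 \<Omega> x + (X $ 2) *\<^sub>R partial 2 \<Omega> x + (- k) *\<^sub>R \<Omega> x = 0"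
      unfolding frechet_derivative_eq_sum_partial[OF diff] by (simp add: sum_2)
    ultimately have "X $ 1 = 0 \<and> X $ 2 = 0"
      unfolding independent3_def by blast
    then show "X = 0" by (simp add: vec_eq_iff forall_2)
  qed
  also have "\<dots> \<longleftrightarrow> jet2 (f \<circ> chart_inv c) (snd c p) \<in> gauss_regular_jets"
    unfolding \<Omega>_def x_def by (rule jet2_gauss_regular_iff[OF F x[unfolded x_def], symmetric])
  finally show ?thesis .
qed

lemma gauss_map_immersion_iff:
  assumes f: "f \<in> immersions M A UNIV"
  shows "gauss_map M A f \<in> immersions M A oriented_Gr \<longleftrightarrow>
    (\<forall>c\<in>A. \<forall>p\<in>fst c. inj (chart_deriv c (gauss_map M A f) p))"
proof -
  have "gauss_map M A f ` topspace M \<subseteq> oriented_Gr"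
    using gauss_map_eq(2)[OF f] by (auto simp flip: cover)
  then show ?thesis
    using gauss_map_smooth[OF f] by (auto simp: immersions_def)
qed

end

section \<open>Generic quadratic perturbations in the plane\<close>

text \<open>Coefficients of the linear monomials \<open>x\<^sub>1, x\<^sub>2\<close> and of the quadratic monomials
  \<open>x\<^sub>1\<^sup>2 / 2, x\<^sub>1 x\<^sub>2, x\<^sub>2\<^sup>2 / 2\<close>: a space of dimension 20.\<close>

type_synonym coeffs = "(real^4) \<times> (real^4) \<times> (real^4) \<times> (real^4) \<times> (real^4)"

fun coeff :: "coeffs \<Rightarrow> nat \<Rightarrow> real^4" where
  "coeff (l1, l2, s11, s12, s22) i = [l1, l2, s11, s12, s22] ! i"

definition quad_monomial :: "nat \<Rightarrow> real^2 \<Rightarrow> real" where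
  "quad_monomial i x = [x $ 1, x $ 2, x $ 1 * x $ 1 / 2, x $ 1 * x $ 2, x $ 2 * x $ 2 / 2] ! i"

definition quad_map :: "coeffs \<Rightarrow> real^2 \<Rightarrow> real^4" where
  "quad_map t x = (\<Sum>i<5. quad_monomial i x *\<^sub>R coeff t i)"

lemma sum_lessThan_5: "(\<Sum>i<5::nat. f i) = f 0 + f 1 + f 2 + f 3 + (f 4 :: 'a::comm_monoid_add)"
  by (simp add: eval_nat_numeral add.assoc)

lemma quad_map_eq: "quad_map (l1, l2, s11, s12, s22) x =
   (x $ 1) *\<^sub>R l1 + (x $ 2) *\<^sub>R l2 + (x $ 1 * x $ 1 / 2) *\<^sub>R s11 + (x $ 1 * x $ 2) *\<^sub>R s12 + (x $ 2 * x $ 2 / 2) *\<^sub>R s22"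
  by (simp add: quad_map_def sum_lessThan_5 quad_monomial_def)

lemma smooth_on_nth: "smooth_on UNIV (\<lambda>x :: real^'n::finite. x $ i)"
  unfolding smooth_on_iff_diff_order
  by (intro allI bounded_linear.diff_order_comp[OF bounded_linear_vec_nth] diff_order_ident open_UNIV)

lemma smooth_on_quad_monomial:
  assumes "i < 5"
  shows "smooth_on UNIV (quad_monomial i)"
proof -
  have i: "i = 0 \<or> i = 1 \<or> i = 2 \<or> i = 3 \<or> i = 4" using assms by auto
  have m: "smooth_on UNIV (\<lambda>x :: real^2. x $ i * x $ j)" for i j
    by (intro bounded_bilinear.smooth_on_prod[OF bounded_bilinear_mult] smooth_on_nth open_UNIV)
  have d: "smooth_on UNIV (\<lambda>x :: real^2. x $ i * x $ j / 2)" for i j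
    unfolding divide_inverse
    by (intro bounded_bilinear.smooth_on_prod[OF bounded_bilinear_mult] smooth_on_nth smooth_on_const open_UNIV)
  show ?thesis
    using i m d smooth_on_nth[where 'n = 2] by (auto simp: quad_monomial_def[abs_def])
qed

lemma smooth_on_quad_map: "smooth_on UNIV (quad_map t)"
  unfolding quad_map_def[abs_def]
  by (intro smooth_on_sum bounded_bilinear.smooth_on_prod[OF bounded_bilinear_scaleR] smooth_on_quad_monomial
      smooth_on_const open_UNIV) auto

lemma pderivs_quad_map:
  fixes t :: coeffs and l1 l2 s11 s12 s22
  defines "t \<equiv> (l1, l2, s11, s12, s22)"
  shows "pderivs [1] (quad_map t) = (\<lambda>x. l1 + (x $ 1) *\<^sub>R s11 + (x $ 2) *\<^sub>R s12)"
    "pderivs [2] (quad_map t) = (\<lambda>x. l2 + (x $ 1) *\<^sub>R s12 + (x $ 2) *\<^sub>R s22)"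
    "pderivs [1, 1] (quad_map t) = (\<lambda>x. s11)" "pderivs [2, 1] (quad_map t) = (\<lambda>x. s12)"
    "pderivs [1, 2] (quad_map t) = (\<lambda>x. s12)" "pderivs [2, 2] (quad_map t) = (\<lambda>x. s22)"
proof -
  have nth: "((\<lambda>x :: real^2. x $ i) has_derivative (\<lambda>h. h $ i)) (at x)" for i x
    by (intro bounded_linear_imp_has_derivative bounded_linear_vec_nth)
  have "(quad_map t has_derivative (\<lambda>h. (h $ 1) *\<^sub>R l1 + (h $ 2) *\<^sub>R l2 + (x $ 1 * h $ 1) *\<^sub>R s11 +
     (x $ 1 * h $ 2 + h $ 1 * x $ 2) *\<^sub>R s12 + (x $ 2 * h $ 2) *\<^sub>R s22)) (at x)" for x
    unfolding t_def quad_map_eq[abs_def]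
    by (rule derivative_eq_intros nth refl | simp add: algebra_simps)+
  from has_derivative_partial[OF this]
  show 1: "pderivs [1] (quad_map t) = (\<lambda>x. l1 + (x $ 1) *\<^sub>R s11 + (x $ 2) *\<^sub>R s12)"
    and 2: "pderivs [2] (quad_map t) = (\<lambda>x. l2 + (x $ 1) *\<^sub>R s12 + (x $ 2) *\<^sub>R s22)"
    by (simp_all add: partial_def fun_eq_iff axis_def)
  have aff: "((\<lambda>x :: real^2. l + (x $ 1) *\<^sub>R s + (x $ 2) *\<^sub>R r) has_derivative (\<lambda>h. (h $ 1) *\<^sub>R s + (h $ 2) *\<^sub>R r)) (at x)"
    for l s r :: "real^4" and x
    by (rule derivative_eq_intros nth refl | simp)+
  have *: "pderivs [i, j] f = partial i (pderivs [j] f)" for i j and f :: "real^2 \<Rightarrow> real^4"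
    by (simp add: partial_def)
  show "pderivs [1, 1] (quad_map t) = (\<lambda>x. s11)" "pderivs [2, 1] (quad_map t) = (\<lambda>x. s12)"
    "pderivs [1, 2] (quad_map t) = (\<lambda>x. s12)" "pderivs [2, 2] (quad_map t) = (\<lambda>x. s22)"
    unfolding * 1 2 using has_derivative_partial[OF aff] by (simp_all add: fun_eq_iff axis_def)
qed

text \<open>A symmetric bilinear form \<open>s\<close> on the plane is determined by \<open>m = s X\<close> for a unit vector \<open>X\<close> together with
  its value \<open>k\<close> on the vector \<open>Y = (- X2, X1)\<close> orthogonal to \<open>X\<close>. Here \<open>\<alpha> = s(X, X)\<close> and \<open>\<beta> = s(X, Y)\<close>, and the conclusion
  is the expansion of \<open>s\<close> in the basis dual to \<open>(X, Y)\<close>.\<close>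

lemma symmetric_form_solution:
  fixes X1 X2 :: real and s11 s12 s22 m1 m2 :: "real^'n"
  assumes X: "X1 * X1 + X2 * X2 = 1"
    and m1: "m1 = X1 *\<^sub>R s11 + X2 *\<^sub>R s12" and m2: "m2 = X1 *\<^sub>R s12 + X2 *\<^sub>R s22"
  defines "k \<equiv> (X2 * X2) *\<^sub>R s11 - (2 * X1 * X2) *\<^sub>R s12 + (X1 * X1) *\<^sub>R s22"
    and "\<alpha> \<equiv> X1 *\<^sub>R m1 + X2 *\<^sub>R m2" and "\<beta> \<equiv> X1 *\<^sub>R m2 - X2 *\<^sub>R m1"
  shows "s11 = (X1 * X1) *\<^sub>R \<alpha> - (2 * X1 * X2) *\<^sub>R \<beta> + (X2 * X2) *\<^sub>R k"
    and "s12 = (X1 * X2) *\<^sub>R \<alpha> + (X1 * X1 - X2 * X2) *\<^sub>R \<beta> - (X1 * X2) *\<^sub>R k"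
    and "s22 = (X2 * X2) *\<^sub>R \<alpha> + (2 * X1 * X2) *\<^sub>R \<beta> + (X1 * X1) *\<^sub>R k"
proof -
  have X2: "(X1 * X1 + X2 * X2) * (X1 * X1 + X2 * X2) = 1" using X by simp
  have 1: "(X1 * X1) *\<^sub>R \<alpha> - (2 * X1 * X2) *\<^sub>R \<beta> + (X2 * X2) *\<^sub>R k = ((X1 * X1 + X2 * X2) * (X1 * X1 + X2 * X2)) *\<^sub>R s11"
    unfolding \<alpha>_def \<beta>_def k_def m1 m2
    by (simp add: vec_eq_iff algebra_simps)
  have 2: "(X1 * X2) *\<^sub>R \<alpha> + (X1 * X1 - X2 * X2) *\<^sub>R \<beta> - (X1 * X2) *\<^sub>R k = ((X1 * X1 + X2 * X2) * (X1 * X1 + X2 * X2)) *\<^sub>R s12"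
    unfolding \<alpha>_def \<beta>_def k_def m1 m2
    by (simp add: vec_eq_iff algebra_simps)
  have 3: "(X2 * X2) *\<^sub>R \<alpha> + (2 * X1 * X2) *\<^sub>R \<beta> + (X1 * X1) *\<^sub>R k = ((X1 * X1 + X2 * X2) * (X1 * X1 + X2 * X2)) *\<^sub>R s22"
    unfolding \<alpha>_def \<beta>_def k_def m1 m2
    by (simp add: vec_eq_iff algebra_simps)
  show "s11 = (X1 * X1) *\<^sub>R \<alpha> - (2 * X1 * X2) *\<^sub>R \<beta> + (X2 * X2) *\<^sub>R k"
    "s12 = (X1 * X2) *\<^sub>R \<alpha> + (X1 * X1 - X2 * X2) *\<^sub>R \<beta> - (X1 * X2) *\<^sub>R k"
    "s22 = (X2 * X2) *\<^sub>R \<alpha> + (2 * X1 * X2) *\<^sub>R \<beta> + (X1 * X1) *\<^sub>R k"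
    unfolding 1 2 3 X2 by simp_all
qed

text \<open>Data of a degenerate perturbed map: the point \<open>x\<close>, the direction \<open>(cos \<theta>, sin \<theta>)\<close> in which the
  Gauss map stands still, the coefficients of the two second derivatives in that direction with respect
  to the first derivatives \<open>u1\<close> and \<open>u2\<close>, these first derivatives, and the remaining second derivative of the
  perturbation. This space has dimension \<open>2 + 1 + 4 + 12 = 19\<close>.\<close>

type_synonym degeneracy =
  "(real^2) \<times> real \<times> real \<times> real \<times> real \<times> real \<times> (real^4) \<times> (real^4) \<times> (real^4)"

text \<open>The data determine the coefficients of the perturbation. The vectors \<open>m1\<close> and \<open>m2\<close> are what the
  perturbation must contribute to the second derivatives in direction \<open>(cos \<theta>, sin \<theta>)\<close>; its quadratic part is
  then the symmetric form found above, and the linear part is read off from \<open>u1\<close> and \<open>u2\<close>.\<close>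

definition degenerate_coeffs :: "(real^2 \<Rightarrow> real^4) \<Rightarrow> degeneracy \<Rightarrow> coeffs" where
  "degenerate_coeffs F = (\<lambda>(x, \<theta>, a, b, a', b', u1, u2, k).
     let m1 = a *\<^sub>R u1 + b *\<^sub>R u2 - cos \<theta> *\<^sub>R pderivs [1, 1] F x - sin \<theta> *\<^sub>R pderivs [2, 1] F x;
         m2 = a' *\<^sub>R u1 + b' *\<^sub>R u2 - cos \<theta> *\<^sub>R pderivs [1, 2] F x - sin \<theta> *\<^sub>R pderivs [2, 2] F x;
         \<alpha> = cos \<theta> *\<^sub>R m1 + sin \<theta> *\<^sub>R m2;
         \<beta> = cos \<theta> *\<^sub>R m2 - sin \<theta> *\<^sub>R m1;
         s11 = (cos \<theta> * cos \<theta>) *\<^sub>R \<alpha> - (2 * cos \<theta> * sin \<theta>) *\<^sub>R \<beta> + (sin \<theta> * sin \<theta>) *\<^sub>R k;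
         s12 = (cos \<theta> * sin \<theta>) *\<^sub>R \<alpha> + (cos \<theta> * cos \<theta> - sin \<theta> * sin \<theta>) *\<^sub>R \<beta> - (cos \<theta> * sin \<theta>) *\<^sub>R k;
         s22 = (sin \<theta> * sin \<theta>) *\<^sub>R \<alpha> + (2 * cos \<theta> * sin \<theta>) *\<^sub>R \<beta> + (cos \<theta> * cos \<theta>) *\<^sub>R k
     in (u1 - pderivs [1] F x - (x $ 1) *\<^sub>R s11 - (x $ 2) *\<^sub>R s12,
         u2 - pderivs [2] F x - (x $ 1) *\<^sub>R s12 - (x $ 2) *\<^sub>R s22, s11, s12, s22))"

lemma differentiable_Pair:
  assumes "f differentiable (at x)" "g differentiable (at x)"
  shows "(\<lambda>x. (f x, g x)) differentiable (at x)"
  using has_derivative_Pair[OF assms[unfolded frechet_derivative_works]] by (rule differentiableI)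

lemma degenerate_coeffs_differentiable:
  assumes "smooth_on W F"
  shows "degenerate_coeffs F differentiable_on (W \<times> UNIV)"
  unfolding differentiable_on_def
proof
  fix q :: degeneracy assume "q \<in> W \<times> UNIV"
  then have q: "fst q \<in> W" by auto
  have lin: "f differentiable (at q)" if "bounded_linear f" for f :: "degeneracy \<Rightarrow> 'c::real_normed_vector"
    using that by (rule bounded_linear_imp_differentiable)
  note proj = bounded_linear_fst_comp bounded_linear_snd_comp bounded_linear_ident
  have P: "(\<lambda>q :: degeneracy. pderivs js F (fst q)) differentiable (at q)" for js
    using differentiable_chain_at[of fst q "pderivs js F"] assms q lin[OF bounded_linear_fst]
    by (auto simp: smooth_on_def o_def)
  have X: "(\<lambda>q :: degeneracy. fst q $ i) differentiable (at q)" for i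
    by (intro lin bounded_linear_compose[OF bounded_linear_vec_nth] proj)
  have th: "(\<lambda>q :: degeneracy. fst (snd q)) differentiable (at q)"
    by (intro lin proj)
  have trig: "(\<lambda>q :: degeneracy. cos (fst (snd q))) differentiable (at q)"
    "(\<lambda>q :: degeneracy. sin (fst (snd q))) differentiable (at q)"
    using has_derivative_cos[OF th[unfolded frechet_derivative_works]]
      has_derivative_sin[OF th[unfolded frechet_derivative_works]] by (auto intro: differentiableI)
  note sc = bounded_bilinear.differentiable[OF bounded_bilinear_scaleR]
    bounded_bilinear.differentiable[OF bounded_bilinear_mult]
  have "degenerate_coeffs F differentiable (at q)"
    unfolding degenerate_coeffs_def case_prod_beta Let_def
    by (intro differentiable_Pair differentiable_add differentiable_diff sc P X trig differentiable_const | (intro lin proj))+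
  then show "degenerate_coeffs F differentiable at q within W \<times> UNIV"
    by (rule differentiable_at_withinI)
qed

lemma jet2_add_quad_map:
  assumes F: "smooth_on W F" and W: "open W" "x \<in> W"
  shows "jet2 (\<lambda>x. F x + quad_map (l1, l2, s11, s12, s22) x) x =
    (pderivs [1] F x + (l1 + (x $ 1) *\<^sub>R s11 + (x $ 2) *\<^sub>R s12),
     pderivs [2] F x + (l2 + (x $ 1) *\<^sub>R s12 + (x $ 2) *\<^sub>R s22),
     pderivs [1, 1] F x + s11, pderivs [1, 2] F x + s12, pderivs [2, 1] F x + s12, pderivs [2, 2] F x + s22)"
proof -
  have "pderivs js (\<lambda>x. F x + quad_map t x) x = pderivs js F x + pderivs js (quad_map t) x" for js t
    by (rule pderivs_add[OF F smooth_on_subset[OF smooth_on_quad_map] W]) simp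
  then show ?thesis
    unfolding jet2_def pderivs_quad_map[symmetric, of l1 s11 s12 l2 s22]
    by (simp only: pderivs_quad_map)
qed

lemma not_regular_unit_direction:
  assumes "(u1, u2, h11, h12, h21, h22) \<in> immersive_jets - gauss_regular_jets"
  shows "\<exists>\<theta> c. wedge (cos \<theta> *\<^sub>R h11 + sin \<theta> *\<^sub>R h21) u2 + wedge u1 (cos \<theta> *\<^sub>R h12 + sin \<theta> *\<^sub>R h22) = c *\<^sub>R wedge u1 u2"
proof -
  have nz: "wedge u1 u2 \<noteq> 0" using assms by (simp add: immersive_jets_def)
  obtain a b c where abc: "a *\<^sub>R (wedge h11 u2 + wedge u1 h12) + b *\<^sub>R (wedge h21 u2 + wedge u1 h22) + c *\<^sub>R wedge u1 u2 = 0"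
    "\<not> (a = 0 \<and> b = 0 \<and> c = 0)"
    using assms unfolding gauss_regular_jets_def independent3_def by auto
  have ab: "a \<noteq> 0 \<or> b \<noteq> 0" using abc nz by auto
  \<comment> \<open>Normalise the direction \<open>(a, b)\<close>; the factor is absorbed in \<open>c\<close>.\<close>
  define r where "r = sqrt (a\<^sup>2 + b\<^sup>2)"
  have r: "r > 0" "r\<^sup>2 = a\<^sup>2 + b\<^sup>2" using ab by (auto simp: r_def sum_power2_gt_zero_iff)
  have "(a / r)\<^sup>2 + (b / r)\<^sup>2 = 1"
    using r(1) by (simp add: power_divide flip: add_divide_distrib r(2))
  then obtain \<theta> where \<theta>: "a / r = cos \<theta>" "b / r = sin \<theta>"
    using sincos_total_2pi by metis
  have "wedge (cos \<theta> *\<^sub>R h11 + sin \<theta> *\<^sub>R h21) u2 + wedge u1 (cos \<theta> *\<^sub>R h12 + sin \<theta> *\<^sub>R h22)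
    = (1 / r) *\<^sub>R (a *\<^sub>R (wedge h11 u2 + wedge u1 h12) + b *\<^sub>R (wedge h21 u2 + wedge u1 h22))"
    by (simp add: \<theta>[symmetric] wedge.add_left wedge.add_right wedge.scaleR_left wedge.scaleR_right algebra_simps)
  also have "a *\<^sub>R (wedge h11 u2 + wedge u1 h12) + b *\<^sub>R (wedge h21 u2 + wedge u1 h22) = (- c) *\<^sub>R wedge u1 u2"
    using abc(1) by (simp only: eq_neg_iff_add_eq_0 scaleR_minus_left)
  finally show ?thesis by (metis scaleR_scaleR)
qed

lemma degenerate_in_image:
  assumes F: "smooth_on W F" and W: "open W" "x \<in> W"
    and deg: "jet2 (\<lambda>x. F x + quad_map t x) x \<in> immersive_jets - gauss_regular_jets"
  shows "t \<in> degenerate_coeffs F ` (W \<times> UNIV)"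
proof -
  obtain l1 l2 s11 s12 s22 where t: "t = (l1, l2, s11, s12, s22)" by (cases t) auto
  define u1 u2 where "u1 = pderivs [1] F x + (l1 + (x $ 1) *\<^sub>R s11 + (x $ 2) *\<^sub>R s12)"
    and "u2 = pderivs [2] F x + (l2 + (x $ 1) *\<^sub>R s12 + (x $ 2) *\<^sub>R s22)"
  have deg': "(u1, u2, pderivs [1, 1] F x + s11, pderivs [1, 2] F x + s12, pderivs [2, 1] F x + s12, pderivs [2, 2] F x + s22)
    \<in> immersive_jets - gauss_regular_jets"
    using deg unfolding t jet2_add_quad_map[OF F W] u1_def u2_def .
  then have nz: "wedge u1 u2 \<noteq> 0" by (simp add: immersive_jets_def)
  obtain \<theta> c where "wedge (cos \<theta> *\<^sub>R (pderivs [1, 1] F x + s11) + sin \<theta> *\<^sub>R (pderivs [2, 1] F x + s12)) u2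
     + wedge u1 (cos \<theta> *\<^sub>R (pderivs [1, 2] F x + s12) + sin \<theta> *\<^sub>R (pderivs [2, 2] F x + s22)) = c *\<^sub>R wedge u1 u2"
    using not_regular_unit_direction[OF deg'] by blast
  from wedge_relation_in_span[OF nz this] obtain a b a' b' where
    ab: "cos \<theta> *\<^sub>R (pderivs [1, 1] F x + s11) + sin \<theta> *\<^sub>R (pderivs [2, 1] F x + s12) = a *\<^sub>R u1 + b *\<^sub>R u2"
      "cos \<theta> *\<^sub>R (pderivs [1, 2] F x + s12) + sin \<theta> *\<^sub>R (pderivs [2, 2] F x + s22) = a' *\<^sub>R u1 + b' *\<^sub>R u2"
    by blast
  define m1 m2 where "m1 = a *\<^sub>R u1 + b *\<^sub>R u2 - cos \<theta> *\<^sub>R pderivs [1, 1] F x - sin \<theta> *\<^sub>R pderivs [2, 1] F x"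
    and "m2 = a' *\<^sub>R u1 + b' *\<^sub>R u2 - cos \<theta> *\<^sub>R pderivs [1, 2] F x - sin \<theta> *\<^sub>R pderivs [2, 2] F x"
  have m: "m1 = cos \<theta> *\<^sub>R s11 + sin \<theta> *\<^sub>R s12" "m2 = cos \<theta> *\<^sub>R s12 + sin \<theta> *\<^sub>R s22"
    unfolding m1_def m2_def ab[symmetric] by (simp_all add: scaleR_add_right)
  have cs: "cos \<theta> * cos \<theta> + sin \<theta> * sin \<theta> = 1"
    using sin_cos_squared_add2[of \<theta>] by (simp add: power2_eq_square)
  \<comment> \<open>The value of the quadratic part on the unit vector \<open>(- sin \<theta>, cos \<theta>)\<close>.\<close>
  define k where "k = (sin \<theta> * sin \<theta>) *\<^sub>R s11 - (2 * cos \<theta> * sin \<theta>) *\<^sub>R s12 + (cos \<theta> * cos \<theta>) *\<^sub>R s22"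
  note sol = symmetric_form_solution[OF cs m, folded k_def]
  have "t = degenerate_coeffs F (x, \<theta>, a, b, a', b', u1, u2, k)"
    unfolding t degenerate_coeffs_def prod.case Let_def m1_def[symmetric] m2_def[symmetric] sol[symmetric]
    by (simp add: u1_def u2_def)
  then show ?thesis using W(2) by blast
qed

text \<open>All bad coefficients lie in the image of a 19-dimensional space under a differentiable map into a
  20-dimensional space. Such an image is negligible, so it contains no ball.\<close>

lemma generic_quad_map:
  assumes F: "smooth_on W F" and W: "open W" and \<delta>: "0 < \<delta>"
  obtains t where "norm t < \<delta>"
    "\<And>x. x \<in> W \<Longrightarrow> jet2 (\<lambda>x. F x + quad_map t x) x \<in> immersive_jets \<Longrightarrow>
      jet2 (\<lambda>x. F x + quad_map t x) x \<in> gauss_regular_jets"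
proof -
  have "negligible (degenerate_coeffs F ` (W \<times> UNIV))"
    by (rule negligible_differentiable_image_lowdim[OF _ degenerate_coeffs_differentiable[OF F]]) simp
  moreover have "\<not> negligible (ball (0 :: coeffs) \<delta>)"
    using \<delta> by (intro open_not_negligible) auto
  ultimately obtain t where "t \<in> ball 0 \<delta>" "t \<notin> degenerate_coeffs F ` (W \<times> UNIV)"
    using negligible_subset by blast
  moreover from this(2) have "jet2 (\<lambda>x. F x + quad_map t x) x \<notin> immersive_jets - gauss_regular_jets" if "x \<in> W" for x
    using degenerate_in_image[OF F W that] by blast
  ultimately show ?thesis
    by (intro that[of t]) (simp, blast)
qed

section \<open>Openness and density\<close>

context surface
begin

lemma immersions_smooth: "immersions M A N \<subseteq> smooth_maps M A"
  by (auto simp: immersions_def)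

text \<open>The bump function at \<open>z\<close> with radius \<open>r\<close> is 1 on a neighbourhood of the cell, so that on the cell the
  cut-off has no effect on the jets of a perturbation, and its support lies in the chart for good cells.\<close>

definition cell :: "'a chart \<Rightarrow> real^2 \<Rightarrow> real \<Rightarrow> 'a set" where
  "cell c z r = chart_inv c ` cball z (r / 2)"

definition good_cell :: "'a chart \<times> (real^2) \<times> real \<Rightarrow> bool" where
  "good_cell = (\<lambda>(c, z, r). c \<in> A \<and> 0 < r \<and> cball z (2 * r) \<subseteq> snd c ` fst c)"

lemma cell_props:
  assumes "good_cell (c, z, r)"
  shows "compactin M (cell c z r)" "cell c z r \<subseteq> fst c" "p \<in> cell c z r \<Longrightarrow> snd c p \<in> cball z (r / 2)"
proof -
  have c: "c \<in> A" and sub: "cball z (r / 2) \<subseteq> snd c ` fst c"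
    using assms by (auto simp: good_cell_def intro: order_trans[OF subset_cball])
  show "compactin M (cell c z r)" "cell c z r \<subseteq> fst c"
    using compactin_chart_inv[OF c compact_cball sub] sub by (auto simp: cell_def intro: inv_into_into)
  show "snd c p \<in> cball z (r / 2)" if "p \<in> cell c z r"
    using that sub by (auto simp: cell_def f_inv_into_f subset_iff simp del: mem_cball)
qed

lemma finite_cell_cover:
  obtains \<C> where "finite \<C>" "\<And>C. C \<in> \<C> \<Longrightarrow> good_cell C" "topspace M = (\<Union>(c, z, r)\<in>\<C>. cell c z r)"
proof -
  have "\<exists>c r. good_cell (c, snd c p, r) \<and> p \<in> fst c" if "p \<in> topspace M" for p
  proof -
    obtain c where c: "c \<in> A" "p \<in> fst c" using \<open>p \<in> topspace M\<close> cover by blast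
    then obtain e where "e > 0" "cball (snd c p) e \<subseteq> snd c ` fst c"
      using open_chart_image[OF c(1)] open_contains_cball by (metis imageI)
    then have "good_cell (c, snd c p, e / 2)" using c by (simp add: good_cell_def)
    then show ?thesis using c by blast
  qed
  then obtain ch rad where g: "\<And>p. p \<in> topspace M \<Longrightarrow> good_cell (ch p, snd (ch p) p, rad p)"
     "\<And>p. p \<in> topspace M \<Longrightarrow> p \<in> fst (ch p)"
    by metis
  define U where "U p = {q \<in> fst (ch p). snd (ch p) q \<in> ball (snd (ch p) p) (rad p / 2)}" for p
  have "openin M (U p)" if "p \<in> topspace M" for p
    unfolding U_def using g(1)[OF that] by (intro openin_vimage_chart) (auto simp: good_cell_def)
  moreover have pU: "p \<in> U p" if "p \<in> topspace M" for p
    using g[OF that] by (auto simp: U_def good_cell_def)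
  ultimately have "\<exists>\<F>. finite \<F> \<and> \<F> \<subseteq> U ` topspace M \<and> topspace M \<subseteq> \<Union>\<F>"
    using compact unfolding compact_space_alt by (auto dest!: spec[of _ "U ` topspace M"])
  then obtain P where P: "finite P" "P \<subseteq> topspace M" "topspace M \<subseteq> (\<Union>p\<in>P. U p)"
    by (metis finite_subset_image)
  have "U p \<subseteq> cell (ch p) (snd (ch p) p) (rad p)" if "p \<in> P" for p
  proof
    fix q assume q: "q \<in> U p"
    have "ch p \<in> A" using g(1) that P(2) by (auto simp: good_cell_def)
    then have "q = chart_inv (ch p) (snd (ch p) q)"
      using q by (simp add: U_def chart_inv_chart)
    moreover have "snd (ch p) q \<in> cball (snd (ch p) p) (rad p / 2)"
      using q by (simp add: U_def)
    ultimately show "q \<in> cell (ch p) (snd (ch p) p) (rad p)"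
      unfolding cell_def by blast
  qed
  moreover have "cell (ch p) (snd (ch p) p) (rad p) \<subseteq> topspace M" if "p \<in> P" for p
    using cell_props(1)[OF g(1)] that P(2) by (meson compactin_subset_topspace subsetD)
  ultimately have "topspace M = (\<Union>p\<in>P. cell (ch p) (snd (ch p) p) (rad p))"
    by (intro equalityI UN_least order_trans[OF P(3) UN_mono]) simp_all
  then show ?thesis
  proof (intro that[of "(\<lambda>p. (ch p, snd (ch p) p, rad p)) ` P"])
    show "good_cell C" if C: "C \<in> (\<lambda>p. (ch p, snd (ch p) p, rad p)) ` P" for C
      using C P(2) g(1) by (elim imageE, simp only:) blast
  qed (use P(1) in simp_all)
qed

definition jets_on_cell :: "two_jet set \<Rightarrow>
    'a chart \<times> (real^2) \<times> real \<Rightarrow> ('a \<Rightarrow> real^4) set" where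
  "jets_on_cell G = (\<lambda>(c, z, r). {f \<in> smooth_maps M A. \<forall>p\<in>cell c z r. jet2 (f \<circ> chart_inv c) (snd c p) \<in> G})"

lemma openin_jets_on_cell:
  assumes "open G" "good_cell C"
  shows "openin (whitney_topology M A) (jets_on_cell G C)"
proof -
  obtain c z r where C: "C = (c, z, r)" by (cases C) auto
  show ?thesis
    unfolding C jets_on_cell_def prod.case
    using assms cell_props[of c z r] by (intro openin_whitney_jet2) (auto simp: C good_cell_def)
qed

text \<open>Being an immersion is a condition on the cells of a cover, for \<open>f\<close> and for its Gauss map alike.\<close>

context
  fixes \<C> assumes good: "\<And>C. C \<in> \<C> \<Longrightarrow> good_cell C" and cells: "topspace M = (\<Union>(c, z, r)\<in>\<C>. cell c z r)"
begin

lemma inj_everywhere_iff_on_cells: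
  fixes g :: "'a \<Rightarrow> 'b::real_normed_vector"
  assumes g: "g \<in> smooth_maps M A"
  shows "(\<forall>c\<in>A. \<forall>p\<in>fst c. inj (chart_deriv c g p)) \<longleftrightarrow>
    (\<forall>(c, z, r)\<in>\<C>. \<forall>p\<in>cell c z r. inj (chart_deriv c g p))"
proof
  assume *: "\<forall>c\<in>A. \<forall>p\<in>fst c. inj (chart_deriv c g p)"
  show "\<forall>(c, z, r)\<in>\<C>. \<forall>p\<in>cell c z r. inj (chart_deriv c g p)"
    using * good cell_props(2) by (fastforce simp: good_cell_def)
next
  assume *: "\<forall>(c, z, r)\<in>\<C>. \<forall>p\<in>cell c z r. inj (chart_deriv c g p)"
  show "\<forall>c\<in>A. \<forall>p\<in>fst c. inj (chart_deriv c g p)"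
  proof (intro ballI)
    fix d p assume d: "d \<in> A" "p \<in> fst d"
    then have "p \<in> topspace M" using chart_domain_subset by blast
    then obtain c z r where c: "(c, z, r) \<in> \<C>" "p \<in> cell c z r"
      using cells by auto
    then have "c \<in> A" "p \<in> fst c" "inj (chart_deriv c g p)"
      using good[OF c(1)] cell_props(2)[OF good[OF c(1)]] * by (auto simp: good_cell_def)
    then show "inj (chart_deriv d g p)"
      using inj_chart_deriv_transition[of c d g p] d g by simp
  qed
qed

lemma immersions_eq_cells:
  "immersions M A UNIV = {f \<in> smooth_maps M A. \<forall>C\<in>\<C>. f \<in> jets_on_cell immersive_jets C}"
proof -
  have "(\<forall>c\<in>A. \<forall>p\<in>fst c. inj (chart_deriv c f p)) \<longleftrightarrow> (\<forall>C\<in>\<C>. f \<in> jets_on_cell immersive_jets C)"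
    if f: "f \<in> smooth_maps M A" for f :: "'a \<Rightarrow> real^4"
  proof -
    have "inj (chart_deriv c f p) \<longleftrightarrow> jet2 (f \<circ> chart_inv c) (snd c p) \<in> immersive_jets"
      if "(c, z, r) \<in> \<C>" "p \<in> cell c z r" for c z r p
      using that good[OF that(1)] cell_props(2)[OF good[OF that(1)]] f
      by (intro inj_chart_deriv_iff) (auto simp: good_cell_def)
    then show ?thesis
      unfolding inj_everywhere_iff_on_cells[OF f] using f by (fastforce simp: jets_on_cell_def)
  qed
  then show ?thesis
    by (auto simp: immersions_def)
qed

lemma gauss_immersion_iff_cells:
  assumes f: "f \<in> immersions M A UNIV"
  shows "gauss_map M A f \<in> immersions M A oriented_Gr \<longleftrightarrow> (\<forall>C\<in>\<C>. f \<in> jets_on_cell gauss_regular_jets C)"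
proof -
  have fs: "f \<in> smooth_maps M A" using f by (simp add: immersions_def)
  have "inj (chart_deriv c (gauss_map M A f) p) \<longleftrightarrow> jet2 (f \<circ> chart_inv c) (snd c p) \<in> gauss_regular_jets"
    if "(c, z, r) \<in> \<C>" "p \<in> cell c z r" for c z r p
    using that good[OF that(1)] cell_props(2)[OF good[OF that(1)]]
    by (intro inj_gauss_deriv_iff f) (auto simp: good_cell_def)
  then show ?thesis
    unfolding gauss_map_immersion_iff[OF f] inj_everywhere_iff_on_cells[OF gauss_map_smooth[OF f]]
    using fs by (fastforce simp: jets_on_cell_def)
qed

end

lemma openin_Collect_jets_on_cells:
  assumes "finite \<C>" "\<And>C. C \<in> \<C> \<Longrightarrow> good_cell C" "open G"
  shows "openin (whitney_topology M A) {f \<in> smooth_maps M A. \<forall>C\<in>\<C>. f \<in> jets_on_cell G C}"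
  using assms(1,2)
proof (induction \<C>)
  case empty
  then show ?case
    using openin_topspace[of "whitney_topology M A :: ('a \<Rightarrow> real^4) topology"] by (simp add: topspace_whitney)
next
  case (insert C \<C>)
  have "{f \<in> smooth_maps M A. \<forall>C\<in>insert C \<C>. f \<in> jets_on_cell G C} =
      jets_on_cell G C \<inter> {f \<in> smooth_maps M A. \<forall>C\<in>\<C>. f \<in> jets_on_cell G C}"
    by (auto simp: jets_on_cell_def)
  then show ?case
    using insert by (simp only:) (intro openin_Int openin_jets_on_cell assms(3), simp_all)
qed

lemma openin_immersions: "openin (whitney_topology M A) (immersions M A UNIV :: ('a \<Rightarrow> real^4) set)"
proof -
  obtain \<C> where \<C>: "finite \<C>" "\<And>C. C \<in> \<C> \<Longrightarrow> good_cell C" "topspace M = (\<Union>(c, z, r)\<in>\<C>. cell c z r)"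
    using finite_cell_cover by blast
  have eq: "(immersions M A UNIV :: ('a \<Rightarrow> real^4) set) =
      {f \<in> smooth_maps M A. \<forall>C\<in>\<C>. f \<in> jets_on_cell immersive_jets C}"
    by (rule immersions_eq_cells) (use \<C> in auto)
  show ?thesis
    unfolding eq by (rule openin_Collect_jets_on_cells) (use \<C> open_immersive_jets in auto)
qed

text \<open>The map \<open>f\<close> is changed by a small quadratic polynomial, cut off by the bump function around the
  cell. For small coefficients the result stays in \<open>T\<close> and is still an immersion, both being open
  conditions; for generic coefficients its Gauss map is regular over the cell.\<close>

lemma dense_on_cell:
  assumes C: "good_cell C" and f: "f \<in> immersions M A UNIV"
    and T: "openin (whitney_topology M A) T" "f \<in> T"
  shows "\<exists>g\<in>T \<inter> immersions M A UNIV. g \<in> jets_on_cell gauss_regular_jets C"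
proof -
  obtain c z r where Ceq: "C = (c, z, r)" by (cases C) auto
  have c: "c \<in> A" and r: "0 < r" and sub: "cball z (2 * r) \<subseteq> snd c ` fst c"
    using C by (auto simp: Ceq good_cell_def)
  note cell = cell_props[OF C[unfolded Ceq]]
  have fs: "f \<in> smooth_maps M A" using f by (simp add: immersions_def)
  define \<beta> where "\<beta> i = extend_by_zero c (\<lambda>x. bump z r x * quad_monomial i x)" for i
  have \<beta>: "\<beta> i \<in> smooth_maps M A" if "i \<in> {..<5}" for i
    unfolding \<beta>_def using that r
    by (intro extend_by_zero_smooth[OF c compact_cball sub]
        bounded_bilinear.smooth_on_prod[OF bounded_bilinear_mult] smooth_on_bump smooth_on_quad_monomial)
      (auto simp: bump_eq_0)
  define pert where "pert t = perturb f {..<5} \<beta> (coeff t)" for t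
  have "((\<lambda>t. coeff t i) \<longlongrightarrow> 0) (nhds 0)" if "i \<in> {..<5}" for i
  proof -
    have "norm (coeff t i) \<le> norm t" for t
    proof -
      obtain l1 l2 s11 s12 s22 where t: "t = (l1, l2, s11, s12, s22)" by (cases t) auto
      have "i = 0 \<or> i = 1 \<or> i = 2 \<or> i = 3 \<or> i = 4" using that by auto
      then show ?thesis
        unfolding t using norm_fst_le[of l1 "(l2, s11, s12, s22)"] norm_snd_le[of "(l2, s11, s12, s22)" l1]
         norm_fst_le[of l2 "(s11, s12, s22)"] norm_snd_le[of "(s11, s12, s22)" l2]
         norm_fst_le[of s11 "(s12, s22)"] norm_snd_le[of "(s12, s22)" s11]
         norm_fst_le[of s12 s22] norm_snd_le[of s22 s12]
        by auto
    qed
    then have "\<forall>\<^sub>F t in nhds 0. norm (coeff t i) \<le> norm t"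
      by (rule always_eventually[OF allI])
    then show ?thesis
      by (rule Lim_null_comparison) (rule tendsto_norm_zero[OF filterlim_ident])
  qed
  then have "limitin (whitney_topology M A) pert f (nhds 0)"
    unfolding pert_def by (intro limitin_perturb fs \<beta>)
  moreover have "openin (whitney_topology M A) (T \<inter> immersions M A UNIV)"
    by (intro openin_Int T openin_immersions)
  ultimately have "eventually (\<lambda>t. pert t \<in> T \<inter> immersions M A UNIV) (nhds 0)"
    using T f by (auto simp: limitin_def)
  then obtain \<delta> where \<delta>: "0 < \<delta>" "\<And>t. norm t < \<delta> \<Longrightarrow> pert t \<in> T \<inter> immersions M A UNIV"
    unfolding eventually_nhds_metric by auto
  have ball: "ball z r \<subseteq> snd c ` fst c"
    using sub r by (force simp: subset_iff)
  have F: "smooth_on (ball z r) (f \<circ> chart_inv c)"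
    by (rule smooth_on_subset[OF smooth_maps_chart[OF c fs] ball])
  obtain t where t: "norm t < \<delta>" "\<And>x. x \<in> ball z r \<Longrightarrow>
      jet2 (\<lambda>x. (f \<circ> chart_inv c) x + quad_map t x) x \<in> immersive_jets \<Longrightarrow>
      jet2 (\<lambda>x. (f \<circ> chart_inv c) x + quad_map t x) x \<in> gauss_regular_jets"
    using generic_quad_map[OF F open_ball \<delta>(1)] by blast
  have imm: "pert t \<in> T \<inter> immersions M A UNIV" by (rule \<delta>(2)[OF t(1)])
  have "jet2 (pert t \<circ> chart_inv c) (snd c p) \<in> gauss_regular_jets" if p: "p \<in> cell c z r" for p
  proof -
    have x: "snd c p \<in> ball z r" using cell(3)[OF p] r by simp
    have "(pert t \<circ> chart_inv c) x = (f \<circ> chart_inv c) x + quad_map t x" if x: "x \<in> ball z r" for x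
    proof -
      obtain q where q: "q \<in> fst c" "x = snd c q" using x ball by blast
      have "(\<beta> i \<circ> chart_inv c) x = quad_monomial i x" for i
        using q x chart_domain_subset[OF c] bump_eq_1[OF r x]
        by (auto simp: \<beta>_def extend_by_zero_def chart_inv_chart[OF c q(1)])
      moreover have "x \<in> snd c ` fst c" using x ball by blast
      ultimately show ?thesis
        unfolding pert_def quad_map_def perturb_chart[OF c \<open>x \<in> snd c ` fst c\<close>] by simp
    qed
    then have "pderivs js (pert t \<circ> chart_inv c) (snd c p) = pderivs js (\<lambda>x. (f \<circ> chart_inv c) x + quad_map t x) (snd c p)" for js
      by (rule pderivs_cong_open[OF open_ball _ x])
    then have jet: "jet2 (pert t \<circ> chart_inv c) (snd c p) = jet2 (\<lambda>x. (f \<circ> chart_inv c) x + quad_map t x) (snd c p)"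
      unfolding jet2_def by (simp only:)
    have "jet2 (pert t \<circ> chart_inv c) (snd c p) \<in> immersive_jets"
      using imm p cell(2) c inj_chart_deriv_iff[of "pert t" c p] by (auto simp: immersions_def)
    then show ?thesis
      using t(2)[OF x] unfolding jet by blast
  qed
  then have "pert t \<in> jets_on_cell gauss_regular_jets C"
    using imm by (auto simp: Ceq jets_on_cell_def immersions_def)
  then show ?thesis using imm by blast
qed

text \<open>Regularity over the cells treated so far is an open condition, so the perturbation for
  the next cell can be chosen without destroying it.\<close>

lemma dense_on_cells:
  assumes "finite \<C>" "\<And>C. C \<in> \<C> \<Longrightarrow> good_cell C" and f: "f \<in> immersions M A UNIV"
    and T: "openin (whitney_topology M A) T" "f \<in> T"
  shows "\<exists>g\<in>T \<inter> immersions M A UNIV. \<forall>C\<in>\<C>. g \<in> jets_on_cell gauss_regular_jets C"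
  using assms(1,2)
proof (induction \<C>)
  case empty
  then show ?case using f T by auto
next
  case (insert C \<C>)
  then obtain g where g: "g \<in> T" "g \<in> immersions M A UNIV" "\<forall>C\<in>\<C>. g \<in> jets_on_cell gauss_regular_jets C"
    by auto
  \<comment> \<open>Regularity over \<open>\<C>\<close> is part of the open set within which \<open>g\<close> is perturbed.\<close>
  define T' where "T' = T \<inter> {f \<in> smooth_maps M A. \<forall>C\<in>\<C>. f \<in> jets_on_cell gauss_regular_jets C}"
  have "openin (whitney_topology M A) T'"
    unfolding T'_def using insert.hyps insert.prems
    by (intro openin_Int T openin_Collect_jets_on_cells open_gauss_regular_jets) auto
  moreover have "g \<in> T'" using g by (auto simp: T'_def immersions_def)
  ultimately obtain h where "h \<in> T' \<inter> immersions M A UNIV" "h \<in> jets_on_cell gauss_regular_jets C"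
    using dense_on_cell[OF _ g(2)] insert.prems by blast
  then show ?case by (auto simp: T'_def)
qed

end

theorem proposition3:
  fixes M :: "'a topology" and A :: "'a chart set"
  assumes "closed_oriented_surface M A"
  shows "generic (immersion_space M A) (\<lambda>f. gauss_map M A f \<in> immersions M A oriented_Gr)"
proof -
  interpret surface M A by unfold_locales (rule assms)
  obtain \<C> where \<C>: "finite \<C>" "\<And>C. C \<in> \<C> \<Longrightarrow> good_cell C" "topspace M = (\<Union>(c, z, r)\<in>\<C>. cell c z r)"
    using finite_cell_cover by blast
  have top: "topspace (immersion_space M A) = immersions M A UNIV"
    using openin_subset[OF openin_immersions] by (auto simp: immersion_space_def)
  define R where "R = {f \<in> smooth_maps M A. \<forall>C\<in>\<C>. f \<in> jets_on_cell gauss_regular_jets C}"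
  have R: "openin (whitney_topology M A) R"
    unfolding R_def by (rule openin_Collect_jets_on_cells[OF \<C>(1,2) open_gauss_regular_jets])
  have eq: "{f \<in> topspace (immersion_space M A). gauss_map M A f \<in> immersions M A oriented_Gr} =
      immersions M A UNIV \<inter> R"
    using gauss_immersion_iff_cells[OF \<C>(2,3)] immersions_smooth by (auto simp: top R_def)
  have "openin (immersion_space M A) (immersions M A UNIV \<inter> R)"
    unfolding immersion_space_def using R by (rule openin_subtopology_Int2)
  moreover have "immersion_space M A closure_of (immersions M A UNIV \<inter> R) = topspace (immersion_space M A)"
  proof (intro antisym closure_of_subset_topspace subsetI)
    fix f assume "f \<in> topspace (immersion_space M A)"
    then have f: "f \<in> immersions M A UNIV" by (simp add: top)
    have "\<exists>g\<in>immersions M A UNIV \<inter> R. g \<in> T" if "openin (immersion_space M A) T" "f \<in> T" for T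
    proof -
      obtain T' where T': "openin (whitney_topology M A) T'" "T = T' \<inter> immersions M A UNIV"
        using \<open>openin (immersion_space M A) T\<close> by (auto simp: immersion_space_def openin_subtopology)
      then obtain g where "g \<in> T' \<inter> immersions M A UNIV" "\<forall>C\<in>\<C>. g \<in> jets_on_cell gauss_regular_jets C"
        using dense_on_cells[OF \<C>(1,2) f T'(1)] \<open>f \<in> T\<close> by blast
      then show ?thesis using T'(2) by (auto simp: R_def immersions_def)
    qed
    then show "f \<in> immersion_space M A closure_of (immersions M A UNIV \<inter> R)"
      using f by (auto simp: in_closure_of top)
  qed
  ultimately show ?thesis
    unfolding generic_def eq by simp
qed

end
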